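(* Let $n\ge 2$, let $\Omega\subsetneq\mathbb{R}^n$ be a domain, and suppose $H^d(\partial\Omega)<\infty$ where $0\le d\le n$. Suppose that $u$ is a nonnegative quasi-nearly subharmonic function in $\Omega$. Let $\varphi:\mathbb{R}_+\to\mathbb{R}_+$ be an admissible function and $\alpha>0$. Let $\psi:\mathbb{R}_+\to\mathbb{R}_+$ be a permissible function. Suppose that $$\int_{\Omega}\psi(u(x))\,\delta(x)^{\gamma}\,dm(x)<\infty$$ for some $\gamma\in\mathbb{R}$. Then $$\lim_{\rho\to0}\Big(\sup_{x\in\Gamma_{\varphi,\rho}(\zeta,\alpha)}\big\{\delta(x)^{n+\gamma}\,[\varphi^{-1}(\delta(x))]^{-d}\,\psi(u(x))\big\}\Big)=0$$ for $H^d$-almost every $(\varphi,\alpha)$-accessible point $\zeta\in\partial\Omega$, where $\Gamma_{\varphi,\rho}(\zeta,\alpha)=\{x\in\Gamma_{\varphi}(\zeta,\alpha):\delta(x)<\rho\}$.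
   Context: Here $\mathbb{R}_+=[0,\infty)$, $m$ is Lebesgue measure on $\mathbb{R}^n$, $B(x,r)$ is the Euclidean ball with center $x$ and radius $r$, $H^d$ is the $d$-dimensional Hausdorff (outer) measure in $\mathbb{R}^n$, and $\delta(x)$ is the distance from $x\in\Omega$ to $\partial\Omega$. Quasi-nearly subharmonic: a Lebesgue measurable function $u:\Omega\to[-\infty,\infty]$ is quasi-nearly subharmonic on $\Omega$ if $u\in\mathcal{L}^1_{\mathrm{loc}}(\Omega)$ (locally integrable on $\Omega$) and there is a constant $C_0=C_0(n,u,\Omega)\ge 1$ such that $u(x)\le \frac{C_0}{r^n}\int_{B(x,r)}u(y)\,dm(y)$ for every ball $B(x,r)\subset\Omega$. $\varDelta_2$-condition: a function $f:\mathbb{R}_+\to\mathbb{R}_+$ satisfies the $\varDelta_2$-condition if there is a constant $C=C(f)\ge1$ with $f(2t)\le C f(t)$ for all $t\in\mathbb{R}_+$. Permissible: a function $\psi:\mathbb{R}_+\to\mathbb{R}_+$ is permissible if there are a nondecreasing convex function $\psi_1:\mathbb{R}_+\to\mathbb{R}_+$ and a (strictly) increasing surjection $\psi_2:\mathbb{R}_+\to\mathbb{R}_+$ with $\psi=\psi_2\circ\psi_1$ such that: (a) $\psi_1$ satisfies the $\varDelta_2$-condition; (b) $\psi_2^{-1}$ satisfies the $\varDelta_2$-condition; (c) the function $t\mapsto t/\psi_2(t)$ is quasi-increasing, i.e. there is a constant $C=C(\psi_2)\ge1$ such that $\frac{s}{\psi_2(s)}\le C\,\frac{t}{\psi_2(t)}$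 for all $0<s\le t$. Admissible: a function $\varphi:\mathbb{R}_+\to\mathbb{R}_+$ is admissible if it is strictly increasing, surjective, and there are constants $C_2>1$ and $r_2>0$ such that $\varphi(2t)\le C_2\,\varphi(t)$ and $\varphi^{-1}(2s)\le C_2\,\varphi^{-1}(s)$ for all $s,t\in\mathbb{R}_+$ with $0\le s,t\le r_2$. Approach regions and accessible points: for $\zeta\in\partial\Omega$, $\varphi$ admissible and $\alpha>0$, put $\Gamma_{\varphi}(\zeta,\alpha)=\{x\in\Omega:\varphi(|x-\zeta|)<\alpha\,\delta(x)\}$. The point $\zeta\in\partial\Omega$ is $(\varphi,\alpha)$-accessible if $\Gamma_{\varphi}(\zeta,\alpha)\cap B(\zeta,\rho)\ne\emptyset$ for all $\rho>0$. *)

theory Defs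
  imports "HOL-Analysis.Analysis"
begin

section \<open>Hausdorff measure\<close>

text \<open>The gauge \<open>diam(E)\<^sup>d\<close> with the usual conventions for \<open>d = 0\<close> (the empty set has gauge 0, all
  other sets have gauge 1); note that \<open>0 powr 0 = 0\<close> in HOL.\<close>

definition hausdorff_gauge :: "real \<Rightarrow> 'a::metric_space set \<Rightarrow> ennreal" where
  "hausdorff_gauge d E =
     (if E = {} then 0 else if d = 0 then 1 else ennreal (diameter E powr d))"

text \<open>Coverings consist of bounded sets since \<^const>\<open>diameter\<close> is unspecified on unbounded ones.
  The measure carries no normalising constant, which affects neither finiteness nor null sets.\<close>

definition hausdorff_content :: "real \<Rightarrow> real \<Rightarrow> 'a::metric_space set \<Rightarrow> ennreal" where
  "hausdorff_content d \<epsilon> A =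
     (INF E\<in>{E :: nat \<Rightarrow> 'a set. A \<subseteq> (\<Union>i. E i) \<and> (\<forall>i. bounded (E i) \<and> diameter (E i) \<le> \<epsilon>)}.
        \<Sum>i. hausdorff_gauge d (E i))"

definition hausdorff_outer_measure :: "real \<Rightarrow> 'a::metric_space set \<Rightarrow> ennreal" where
  "hausdorff_outer_measure d A = (SUP \<epsilon>\<in>{0<..}. hausdorff_content d \<epsilon> A)"

section \<open>Quasi-nearly subharmonic functions\<close>

text \<open>\<open>\<integral>\<^sub>A u\<^sup>+ dm - \<integral>\<^sub>A u\<^sup>- dm\<close>, where \<^const>\<open>e2ennreal\<close> sends negative values to 0. It is the
  Lebesgue integral unless both parts are infinite, in which case HOL gives \<open>\<infinity> - \<infinity> = \<infinity>\<close>.\<close>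

definition ereal_lebesgue_integral :: "'a::euclidean_space set \<Rightarrow> ('a \<Rightarrow> ereal) \<Rightarrow> ereal" where
  "ereal_lebesgue_integral A u =
     enn2ereal (\<integral>\<^sup>+x\<in>A. e2ennreal (u x) \<partial>lebesgue) - enn2ereal (\<integral>\<^sup>+x\<in>A. e2ennreal (- u x) \<partial>lebesgue)"

definition locally_integrable :: "'a::euclidean_space set \<Rightarrow> ('a \<Rightarrow> ereal) \<Rightarrow> bool" where
  "locally_integrable \<Omega> u \<longleftrightarrow>
     u \<in> borel_measurable (lebesgue_on \<Omega>) \<and>
     (\<forall>K. compact K \<and> K \<subseteq> \<Omega> \<longrightarrow> (\<integral>\<^sup>+x\<in>K. e2ennreal \<bar>u x\<bar> \<partial>lebesgue) < \<infinity>)"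

definition quasi_nearly_subharmonic :: "'a::euclidean_space set \<Rightarrow> ('a \<Rightarrow> ereal) \<Rightarrow> bool" where
  "quasi_nearly_subharmonic \<Omega> u \<longleftrightarrow>
     locally_integrable \<Omega> u \<and>
     (\<exists>C\<ge>1. \<forall>x r. 0 < r \<and> ball x r \<subseteq> \<Omega> \<longrightarrow>
        u x \<le> ereal (C / r ^ DIM('a)) * ereal_lebesgue_integral (ball x r) u)"

text \<open>A nonnegative quasi-nearly subharmonic function on an open set is finite there, so nothing is
  lost by evaluating real functions at \<^term>\<open>real_of_ereal (u x)\<close>.\<close>

lemma quasi_nearly_subharmonic_nonneg_finite:
  assumes "quasi_nearly_subharmonic \<Omega> u" "open \<Omega>" "x \<in> \<Omega>" "\<forall>x\<in>\<Omega>. 0 \<le> u x"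
  shows "\<bar>u x\<bar> \<noteq> \<infinity>"
proof -
  have loc: "locally_integrable \<Omega> u"
    and "\<exists>C\<ge>1. \<forall>x r. 0 < r \<and> ball x r \<subseteq> \<Omega> \<longrightarrow>
        u x \<le> ereal (C / r ^ DIM('a)) * ereal_lebesgue_integral (ball x r) u"
    using assms(1) by (simp_all only: quasi_nearly_subharmonic_def)
  then obtain C where C: "\<And>x r. 0 < r \<Longrightarrow> ball x r \<subseteq> \<Omega> \<Longrightarrow>
        u x \<le> ereal (C / r ^ DIM('a)) * ereal_lebesgue_integral (ball x r) u"
    by metis
  obtain r where r: "r > 0" "cball x r \<subseteq> \<Omega>"
    using assms(2,3) open_contains_cball by blast
  then have sub: "ball x r \<subseteq> \<Omega>"
    using ball_subset_cball by blast
  let ?I = "\<integral>\<^sup>+y\<in>ball x r. e2ennreal (u y) \<partial>lebesgue"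
  let ?J = "\<integral>\<^sup>+y\<in>ball x r. e2ennreal (- u y) \<partial>lebesgue"
  have "?I \<le> (\<integral>\<^sup>+y\<in>cball x r. e2ennreal \<bar>u y\<bar> \<partial>lebesgue)"
  proof (intro nn_integral_mono mult_mono e2ennreal_mono)
    fix y
    show "u y \<le> \<bar>u y\<bar>" by (cases "u y") simp_all
    show "indicator (ball x r) y \<le> (indicator (cball x r) y :: ennreal)"
      by (simp add: indicator_def)
  qed simp_all
  also have "\<dots> < \<infinity>"
    using loc[unfolded locally_integrable_def, THEN conjunct2, rule_format, of "cball x r"] r(2)
    by simp
  finally have I: "?I < \<infinity>" .
  have "(\<lambda>y. e2ennreal (- u y) * indicator (ball x r) y) = (\<lambda>y. 0)"
  proof
    fix y
    show "e2ennreal (- u y) * indicator (ball x r) y = 0"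
    proof (cases "y \<in> ball x r")
      case True
      then have "0 \<le> u y" using assms(4) sub by blast
      then show ?thesis by (simp add: e2ennreal_neg)
    next
      case False
      then show ?thesis by (simp add: indicator_def)
    qed
  qed
  then have J: "?J = 0"
    by (simp only: nn_integral_const mult_zero_left)
  obtain c where c: "?I = ennreal c" "0 \<le> c"
    using I by (metis ennreal_cases infinity_ennreal_def less_irrefl)
  have "ereal_lebesgue_integral (ball x r) u = ereal c"
    unfolding ereal_lebesgue_integral_def J c(1)
    using c(2) by (simp add: zero_ennreal.rep_eq)
  with C[OF r(1) sub] have "u x \<le> ereal (C / r ^ DIM('a) * c)"
    by simp
  moreover have "0 \<le> u x"
    using assms(3,4) by blast
  ultimately show ?thesis
    by (cases "u x") simp_all
qed

section \<open>Permissible and admissible functions\<close>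

text \<open>Functions \<open>\<real>\<^sub>+ \<rightarrow> \<real>\<^sub>+\<close> are functions \<^typ>\<open>real \<Rightarrow> real\<close> whose values outside \<open>[0, \<infinity>)\<close> are
  irrelevant; their inverses are inverses on \<open>[0, \<infinity>)\<close>.\<close>

definition delta2_condition :: "(real \<Rightarrow> real) \<Rightarrow> bool" where
  "delta2_condition f \<longleftrightarrow> (\<exists>C\<ge>1. \<forall>t\<ge>0. f (2 * t) \<le> C * f t)"

definition permissible :: "(real \<Rightarrow> real) \<Rightarrow> bool" where
  "permissible \<psi> \<longleftrightarrow>
     (\<exists>\<psi>\<^sub>1 \<psi>\<^sub>2.
        \<psi>\<^sub>1 \<in> {0..} \<rightarrow> {0..} \<and> mono_on {0..} \<psi>\<^sub>1 \<and> convex_on {0..} \<psi>\<^sub>1 \<and>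
        strict_mono_on {0..} \<psi>\<^sub>2 \<and> \<psi>\<^sub>2 ` {0..} = {0..} \<and>
        (\<forall>t\<ge>0. \<psi> t = \<psi>\<^sub>2 (\<psi>\<^sub>1 t)) \<and>
        delta2_condition \<psi>\<^sub>1 \<and>
        delta2_condition (inv_into {0..} \<psi>\<^sub>2) \<and>
        (\<exists>C\<ge>1. \<forall>s t. 0 < s \<and> s \<le> t \<longrightarrow> s / \<psi>\<^sub>2 s \<le> C * (t / \<psi>\<^sub>2 t)))"

definition admissible :: "(real \<Rightarrow> real) \<Rightarrow> bool" where
  "admissible \<phi> \<longleftrightarrow>
     strict_mono_on {0..} \<phi> \<and> \<phi> ` {0..} = {0..} \<and>
     (\<exists>C>1. \<exists>r>0. \<forall>s t. 0 \<le> s \<and> s \<le> r \<and> 0 \<le> t \<and> t \<le> r \<longrightarrow>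
        \<phi> (2 * t) \<le> C * \<phi> t \<and>
        inv_into {0..} \<phi> (2 * s) \<le> C * inv_into {0..} \<phi> s)"

section \<open>Approach regions\<close>

definition boundary_dist :: "'a::metric_space set \<Rightarrow> 'a \<Rightarrow> real" where
  "boundary_dist \<Omega> x = infdist x (frontier \<Omega>)"

definition approach_region ::
  "'a::metric_space set \<Rightarrow> (real \<Rightarrow> real) \<Rightarrow> 'a \<Rightarrow> real \<Rightarrow> 'a set" where
  "approach_region \<Omega> \<phi> \<zeta> \<alpha> = {x \<in> \<Omega>. \<phi> (dist x \<zeta>) < \<alpha> * boundary_dist \<Omega> x}"

definition approach_region_below ::
  "'a::metric_space set \<Rightarrow> (real \<Rightarrow> real) \<Rightarrow> real \<Rightarrow> 'a \<Rightarrow> real \<Rightarrow> 'a set" where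
  "approach_region_below \<Omega> \<phi> \<rho> \<zeta> \<alpha> = {x \<in> approach_region \<Omega> \<phi> \<zeta> \<alpha>. boundary_dist \<Omega> x < \<rho>}"

definition accessible ::
  "'a::metric_space set \<Rightarrow> (real \<Rightarrow> real) \<Rightarrow> real \<Rightarrow> 'a \<Rightarrow> bool" where
  "accessible \<Omega> \<phi> \<alpha> \<zeta> \<longleftrightarrow>
     \<zeta> \<in> frontier \<Omega> \<and> (\<forall>\<rho>>0. approach_region \<Omega> \<phi> \<zeta> \<alpha> \<inter> ball \<zeta> \<rho> \<noteq> {})"

end

theory Submission
  imports Defs
begin

text \<open>The function \<open>\<psi> \<circ> u\<close> again satisfies a mean value inequality. Applied on \<open>B(x, \<delta>(x)/3)\<close>, where
  \<open>\<delta>\<close> is comparable to \<open>\<delta>(x)\<close>, it gives \<open>\<delta>(x)\<^sup>n\<^sup>+\<^sup>\<gamma> \<psi>(u(x)) \<le> C \<mu>(B(x, \<delta>(x)/3))\<close> for the finite measure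
  \<open>\<mu> = \<psi>(u) \<delta>\<^sup>\<gamma> dm\<close> on \<open>\<Omega>\<close>. For \<open>x\<close> in the approach region at \<open>\<zeta>\<close> and close to the boundary, this ball
  lies in a ball around \<open>\<zeta>\<close> whose radius \<open>t\<close> is a constant multiple of \<open>\<phi>\<inverse>(\<delta>(x))\<close>. So if the limit
  fails at \<open>\<zeta>\<close>, then the upper \<open>d\<close>-density \<open>limsup t\<^sup>-\<^sup>d \<mu>(B(\<zeta>, t))\<close> is positive. Since
  \<open>\<mu>(\<partial>\<Omega>) = 0\<close>, Vitali's covering lemma and \<open>\<mu>({\<delta> < r}) \<rightarrow> 0\<close> show that such \<open>\<zeta>\<close> form an
  \<open>H\<^sup>d\<close>-null set.\<close>

section \<open>Hausdorff null sets and upper densities\<close>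

text \<open>A supremum over scales vanishes only if every content does, and a content vanishes only
  if arbitrarily cheap coverings exist. Null sets are handled below through such coverings, without
  returning to the supremum and infimum.\<close>

lemma hausdorff_outer_measure_eq_0_iff:
  "hausdorff_outer_measure d A = 0 \<longleftrightarrow>
     (\<forall>\<epsilon>>0. \<forall>\<eta>>0. \<exists>E. A \<subseteq> (\<Union>i. E i) \<and> (\<forall>i. bounded (E i) \<and> diameter (E i) \<le> \<epsilon>) \<and>
        (\<Sum>i. hausdorff_gauge d (E i)) < ennreal \<eta>)"
proof -
  have "hausdorff_content d \<epsilon> A = 0 \<longleftrightarrow>
      (\<forall>\<eta>>0. \<exists>E. A \<subseteq> (\<Union>i. E i) \<and> (\<forall>i. bounded (E i) \<and> diameter (E i) \<le> \<epsilon>) \<and>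
        (\<Sum>i. hausdorff_gauge d (E i)) < ennreal \<eta>)" for \<epsilon>
  proof -
    have "hausdorff_content d \<epsilon> A = 0 \<longleftrightarrow> (\<forall>\<eta>>0. hausdorff_content d \<epsilon> A < ennreal \<eta>)"
    proof
      assume *: "\<forall>\<eta>>0. hausdorff_content d \<epsilon> A < ennreal \<eta>"
      have "hausdorff_content d \<epsilon> A \<le> 0"
        by (rule ennreal_le_epsilon) (use * in \<open>auto intro: less_imp_le\<close>)
      then show "hausdorff_content d \<epsilon> A = 0" by simp
    qed auto
    then show ?thesis
      by (simp add: hausdorff_content_def INF_less_iff conj_assoc)
  qed
  moreover have "hausdorff_outer_measure d A = 0 \<longleftrightarrow> (\<forall>\<epsilon>>0. hausdorff_content d \<epsilon> A = 0)"
    by (simp add: hausdorff_outer_measure_def SUP_eq_iff bot_ennreal)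
      (metis (no_types, lifting) SUP_bot_conv(1) bot_ennreal greaterThan_iff)
  ultimately show ?thesis by simp
qed

lemma hausdorff_outer_measure_mono_null:
  assumes "hausdorff_outer_measure d B = 0" "A \<subseteq> B"
  shows "hausdorff_outer_measure d A = 0"
  using assms unfolding hausdorff_outer_measure_eq_0_iff by (meson order_trans)

lemma hausdorff_outer_measure_UN_null:
  fixes A :: "nat \<Rightarrow> 'a::metric_space set"
  assumes null: "\<And>k. hausdorff_outer_measure d (A k) = 0"
  shows "hausdorff_outer_measure d (\<Union>k. A k) = 0"
  unfolding hausdorff_outer_measure_eq_0_iff
proof (intro allI impI)
  fix \<epsilon> \<eta> :: real assume pos: "0 < \<epsilon>" "0 < \<eta>"
  \<comment> \<open>The k-th covering gets the budget \<open>\<eta> / 2^(k+2)\<close>; these add up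
    to \<open>\<eta> / 2\<close>, which keeps the final bound strict.\<close>
  have "\<exists>E. A k \<subseteq> (\<Union>i. E i) \<and> (\<forall>i. bounded (E i) \<and> diameter (E i) \<le> \<epsilon>) \<and>
      (\<Sum>i. hausdorff_gauge d (E i)) < ennreal (\<eta> / 2 * (1/2) ^ Suc k)" for k
    using null[of k] pos unfolding hausdorff_outer_measure_eq_0_iff by simp
  then obtain E where E: "\<And>k. A k \<subseteq> (\<Union>i. E k i)"
    "\<And>k i. bounded (E k i) \<and> diameter (E k i) \<le> \<epsilon>"
    "\<And>k. (\<Sum>i. hausdorff_gauge d (E k i)) < ennreal (\<eta> / 2 * (1/2) ^ Suc k)"
    by metis
  define F where "F = (\<lambda>i. case prod_decode i of (k, j) \<Rightarrow> E k j)"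
  have "(\<Union>k. A k) \<subseteq> (\<Union>i. F i)"
  proof
    fix x assume "x \<in> (\<Union>k. A k)"
    then obtain k i where "x \<in> E k i" using E(1) by blast
    then have "x \<in> F (prod_encode (k, i))" by (simp add: F_def)
    then show "x \<in> (\<Union>i. F i)" by blast
  qed
  moreover have "\<forall>i. bounded (F i) \<and> diameter (F i) \<le> \<epsilon>"
    using E(2) by (simp add: F_def split: prod.split)
  moreover have "(\<Sum>i. hausdorff_gauge d (F i)) < ennreal \<eta>"
  proof -
    have sums: "(\<lambda>k. \<eta> / 2 * (1/2) ^ Suc k) sums (\<eta> / 2 * 1)"
      by (intro sums_mult power_half_series)
    have "(\<Sum>i. hausdorff_gauge d (F i))
        = (\<Sum>i. case prod_decode i of (k, j) \<Rightarrow> hausdorff_gauge d (E k j))"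
      by (intro suminf_cong) (simp add: F_def split: prod.split)
    also have "\<dots> = (\<Sum>k. \<Sum>j. hausdorff_gauge d (E k j))"
      by (rule suminf_ennreal_2dimen) simp
    also have "\<dots> \<le> (\<Sum>k. ennreal (\<eta> / 2 * (1/2) ^ Suc k))"
      by (intro suminf_le less_imp_le E(3)) simp_all
    also have "\<dots> = ennreal (\<eta> / 2 * 1)"
      by (rule suminf_ennreal_eq[OF _ sums]) (use pos in simp)
    also have "\<dots> < ennreal \<eta>"
      using pos by (simp add: ennreal_less_iff)
    finally show ?thesis .
  qed
  ultimately show "\<exists>E. (\<Union>k. A k) \<subseteq> (\<Union>i. E i) \<and> (\<forall>i. bounded (E i) \<and> diameter (E i) \<le> \<epsilon>) \<and>
        (\<Sum>i. hausdorff_gauge d (E i)) < ennreal \<eta>" by blast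
qed

lemma hausdorff_gauge_cball:
  fixes z :: "'a::euclidean_space"
  assumes "0 < r"
  shows "hausdorff_gauge d (cball z r) = ennreal ((2 * r) powr d)"
  using assms by (auto simp: hausdorff_gauge_def)

section \<open>Points where a finite measure has positive upper density\<close>

text \<open>The neighbourhoods of radius \<open>1 / (n + 1)\<close> decrease to \<open>A\<close>
  because \<open>A\<close> is closed, and a finite measure is continuous from above along
  them.\<close>

lemma tendsto_emeasure_infdist_nbhd:
  fixes A :: "'a::metric_space set"
  assumes "finite_measure M" "sets borel \<subseteq> sets M" "closed A" "A \<noteq> {}" "emeasure M A = 0" "0 < \<eta>"
  shows "\<exists>r>0. emeasure M {x. infdist x A < r} < \<eta>"
proof -
  interpret finite_measure M by fact
  define S where "S n = {x. infdist x A < 1 / real (Suc n)}" for n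
  have op: "open {x. infdist x A < r}" for r
    by (intro open_Collect_less continuous_intros)
  have S: "range S \<subseteq> sets M"
    using op assms(2) by (auto simp: S_def)
  have "decseq S"
    unfolding decseq_def S_def
    by (auto elim!: order.strict_trans2 intro!: divide_left_mono)
  moreover have "(\<Inter>n. S n) = A"
  proof
    show "(\<Inter>n. S n) \<subseteq> A"
    proof
      fix x assume x: "x \<in> (\<Inter>n. S n)"
      have "infdist x A \<le> 0"
      proof (rule ccontr)
        assume "\<not> infdist x A \<le> 0"
        then obtain n where "1 / real (Suc n) < infdist x A"
          using nat_approx_posE not_le by blast
        moreover have "x \<in> S n" using x by blast
        ultimately show False by (simp add: S_def)
      qed
      then show "x \<in> A"
        using in_closed_iff_infdist_zero[OF assms(3,4)] infdist_nonneg[of x A] by auto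
    qed
  qed (auto simp: S_def)
  ultimately have "(INF n. emeasure M (S n)) = 0"
    using INF_emeasure_decseq[OF S] assms(5) by simp
  then have "(INF n. emeasure M (S n)) < \<eta>" using assms(6) by simp
  then obtain n where "emeasure M (S n) < \<eta>" by (auto simp: INF_less_iff)
  then show ?thesis unfolding S_def by (intro exI[of _ "1 / real (Suc n)"]) auto
qed

text \<open>Vitali's lemma selects disjoint balls among the small balls of large measure so that
  their 5-fold enlargements cover the set. The gauges of the enlargements add up to at most a
  constant times the measure of a thin neighbourhood of \<open>A\<close>, which is as small as
  desired since \<open>A\<close> is null for \<open>M\<close>.\<close>

lemma hausdorff_null_upper_density_ge:
  fixes A :: "'a::euclidean_space set"
  assumes "finite_measure M" "sets borel \<subseteq> sets M" "closed A" "emeasure M A = 0" "0 \<le> d" "0 < c"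
  shows "hausdorff_outer_measure d
    {z \<in> A. \<forall>\<epsilon>>0. \<exists>t. 0 < t \<and> t < \<epsilon> \<and> ennreal (t powr d) \<le> ennreal c * emeasure M (cball z t)} = 0"
    (is "hausdorff_outer_measure d ?E = 0")
  unfolding hausdorff_outer_measure_eq_0_iff
proof (intro allI impI)
  fix \<epsilon> \<eta> :: real assume pos: "0 < \<epsilon>" "0 < \<eta>"
  let ?goal = "\<exists>E. ?E \<subseteq> (\<Union>i. E i) \<and> (\<forall>i. bounded (E i) \<and> diameter (E i) \<le> \<epsilon>) \<and>
        (\<Sum>i. hausdorff_gauge d (E i)) < ennreal \<eta>"
  show ?goal
  proof (cases "A = {}")
    case True
    have "(\<Sum>i::nat. hausdorff_gauge d ({} :: 'a set)) < ennreal \<eta>"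
      using pos by (simp add: hausdorff_gauge_def)
    with True pos show ?thesis by (intro exI[of _ "\<lambda>i. {}"]) simp
  next
    case False
    \<comment> \<open>An enlarged ball has radius \<open>5 * t\<close> and diameter
      \<open>10 * t\<close>, so its gauge is at most \<open>q\<close> times the measure of the
      original ball.\<close>
    define q where "q = 10 powr d * c"
    have q: "0 < q" using assms(6) by (simp add: q_def)
    obtain r where r: "r > 0" "emeasure M {x. infdist x A < r} < ennreal (\<eta> / q)"
      using tendsto_emeasure_infdist_nbhd[OF assms(1-3) False assms(4), of "ennreal (\<eta> / q)"] pos q
      by auto
    \<comment> \<open>Radii below \<open>r\<close> keep the balls in the neighbourhood of small
      measure; radii below \<open>\<epsilon> / 10\<close> keep the diameters of the enlarged balls
      below \<open>\<epsilon>\<close>.\<close>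
    define \<rho> where "\<rho> = min r (\<epsilon> / 10)"
    have \<rho>: "0 < \<rho>" "\<rho> \<le> r" "10 * \<rho> \<le> \<epsilon>" using r pos by (auto simp: \<rho>_def)
    have "\<forall>z\<in>?E. \<exists>t. 0 < t \<and> t < \<rho> \<and> ennreal (t powr d) \<le> ennreal c * emeasure M (cball z t)"
      using \<rho> by blast
    then obtain t where t: "\<And>z. z \<in> ?E \<Longrightarrow> 0 < t z" "\<And>z. z \<in> ?E \<Longrightarrow> t z < \<rho>"
      "\<And>z. z \<in> ?E \<Longrightarrow> ennreal (t z powr d) \<le> ennreal c * emeasure M (cball z (t z))"
      unfolding bchoice_iff by blast
    have cover: "?E \<subseteq> (\<Union>z\<in>?E. cball z (t z))"
    proof
      fix z assume "z \<in> ?E"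
      moreover from t(1)[OF this] have "z \<in> cball z (t z)" by simp
      ultimately show "z \<in> (\<Union>z\<in>?E. cball z (t z))" by (rule UN_I)
    qed
    obtain C where C: "countable C" "C \<subseteq> ?E"
      "pairwise (\<lambda>i j. disjnt (cball i (t i)) (cball j (t j))) C"
      "?E \<subseteq> (\<Union>i\<in>C. cball i (5 * t i))"
      by (rule Vitali_covering_lemma_cballs[OF cover, of \<rho>])
        (auto intro: t(1) less_imp_le[OF t(2)])
    define e where "e = to_nat_on C"
    have inj: "inj_on e C" unfolding e_def using C(1) by (rule inj_on_to_nat_on)
    define I where "I = e ` C"
    define g where "g = inv_into C e"
    have g: "g i \<in> C" if "i \<in> I" for i
      using that by (simp add: I_def g_def inv_into_into)
    have ge: "g (e z) = z" if "z \<in> C" for z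
      using that inj by (simp add: g_def)
    have injg: "inj_on g I" unfolding g_def I_def by (rule inj_on_inv_into) simp
    define F where "F i = (if i \<in> I then cball (g i) (5 * t (g i)) else {})" for i
    define G where "G i = (if i \<in> I then cball (g i) (t (g i)) else {})" for i
    have tg: "0 < t (g i)" "t (g i) < \<rho>"
      "ennreal (t (g i) powr d) \<le> ennreal c * emeasure M (cball (g i) (t (g i)))"
      "g i \<in> A" if "i \<in> I" for i
      using t[of "g i"] g[OF that] C(2) by auto
    have "?E \<subseteq> (\<Union>i. F i)"
    proof
      fix x assume "x \<in> ?E"
      then obtain z where z: "z \<in> C" "x \<in> cball z (5 * t z)" using C(4) by blast
      then have "x \<in> F (e z)" by (auto simp: F_def I_def ge)
      then show "x \<in> (\<Union>i. F i)" by blast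
    qed
    moreover have "bounded (F i) \<and> diameter (F i) \<le> \<epsilon>" for i
      using tg(1,2)[of i] \<rho> pos by (auto simp: F_def)
    moreover have "(\<Sum>i. hausdorff_gauge d (F i)) < ennreal \<eta>"
    proof -
      have gauge: "hausdorff_gauge d (F i) \<le> ennreal q * emeasure M (G i)" for i
      proof (cases "i \<in> I")
        case True
        have "hausdorff_gauge d (F i) = ennreal (10 powr d) * ennreal (t (g i) powr d)"
          using tg(1)[OF True] True
          by (simp add: F_def hausdorff_gauge_cball powr_mult flip: ennreal_mult)
        also have "\<dots> \<le> ennreal (10 powr d) * (ennreal c * emeasure M (cball (g i) (t (g i))))"
          by (intro mult_left_mono tg(3)[OF True]) simp
        finally show ?thesis
          using True assms(6) by (simp add: q_def G_def ennreal_mult mult.assoc)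
      qed (simp add: F_def hausdorff_gauge_def)
      have Gs: "range G \<subseteq> sets M"
        using assms(2) by (auto simp: G_def)
      have disj: "disjoint_family G"
        unfolding disjoint_family_on_def
      proof (intro ballI impI)
        fix i j :: nat assume "i \<noteq> j"
        then show "G i \<inter> G j = {}"
          using C(3) g[of i] g[of j] injg
          by (auto simp: G_def pairwise_def disjnt_def inj_on_def)
      qed
      have Gsub: "(\<Union>i. G i) \<subseteq> {x. infdist x A < r}"
      proof
        fix x assume "x \<in> (\<Union>i. G i)"
        then obtain i where i: "i \<in> I" "dist (g i) x \<le> t (g i)"
          by (auto simp: G_def split: if_splits)
        have "infdist x A \<le> t (g i)"
          using i tg(4)[OF i(1)] by (intro infdist_le2) (auto simp: dist_commute)
        then show "x \<in> {x. infdist x A < r}"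
          using tg(2)[OF i(1)] \<rho> by simp
      qed
      have "open {x. infdist x A < r}"
        by (intro open_Collect_less continuous_intros)
      then have nbhd: "{x. infdist x A < r} \<in> sets M" using assms(2) by auto
      have "(\<Sum>i. hausdorff_gauge d (F i)) \<le> (\<Sum>i. ennreal q * emeasure M (G i))"
        by (intro suminf_le gauge) simp_all
      also have "\<dots> = ennreal q * emeasure M (\<Union>i. G i)"
        using suminf_emeasure[OF Gs disj] by simp
      also have "\<dots> \<le> ennreal q * emeasure M {x. infdist x A < r}"
        by (intro mult_left_mono emeasure_mono Gsub nbhd) simp
      also have "\<dots> < ennreal q * ennreal (\<eta> / q)"
        using r(2) q by (intro ennreal_mult_strict_left_mono) auto
      also have "\<dots> = ennreal \<eta>"
        using q pos by (simp flip: ennreal_mult)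
      finally show ?thesis .
    qed
    ultimately show ?thesis by blast
  qed
qed

text \<open>The constant may vary from point to point. The inequality weakens as \<open>c\<close>
  grows, so the set lies in the countable union of the null sets for
  \<open>c = 1, 2, 3, ...\<close>.\<close>

lemma hausdorff_null_upper_density_pos:
  fixes A :: "'a::euclidean_space set"
  assumes "finite_measure M" "sets borel \<subseteq> sets M" "closed A" "emeasure M A = 0" "0 \<le> d"
  shows "hausdorff_outer_measure d
    {z \<in> A. \<exists>c>0. \<forall>\<epsilon>>0. \<exists>t. 0 < t \<and> t < \<epsilon> \<and>
       ennreal (t powr d) \<le> ennreal c * emeasure M (cball z t)} = 0"
proof (rule hausdorff_outer_measure_mono_null)
  let ?E = "\<lambda>k. {z \<in> A. \<forall>\<epsilon>>0. \<exists>t. 0 < t \<and> t < \<epsilon> \<and>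
    ennreal (t powr d) \<le> ennreal (real (Suc k)) * emeasure M (cball z t)}"
  show "hausdorff_outer_measure d (\<Union>k. ?E k) = 0"
    by (intro hausdorff_outer_measure_UN_null hausdorff_null_upper_density_ge assms) simp
  show "{z \<in> A. \<exists>c>0. \<forall>\<epsilon>>0. \<exists>t. 0 < t \<and> t < \<epsilon> \<and>
       ennreal (t powr d) \<le> ennreal c * emeasure M (cball z t)} \<subseteq> (\<Union>k. ?E k)"
  proof clarify
    fix z and c :: real
    assume z: "z \<in> A" "0 < c" and *: "\<forall>\<epsilon>>0. \<exists>t. 0 < t \<and> t < \<epsilon> \<and>
       ennreal (t powr d) \<le> ennreal c * emeasure M (cball z t)"
    obtain k where "c \<le> real k" using real_arch_simple by blast
    then have k: "c \<le> real (Suc k)" by simp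
    have le: "ennreal c * m \<le> ennreal (real (Suc k)) * m" for m
      by (intro mult_right_mono ennreal_leI k) simp
    have "z \<in> ?E k"
    proof (intro CollectI conjI z(1) allI impI)
      fix \<epsilon> :: real assume "0 < \<epsilon>"
      with * obtain t where t: "0 < t" "t < \<epsilon>"
        "ennreal (t powr d) \<le> ennreal c * emeasure M (cball z t)" by blast
      from t(1,2) order_trans[OF t(3) le]
      show "\<exists>t. 0 < t \<and> t < \<epsilon> \<and>
          ennreal (t powr d) \<le> ennreal (real (Suc k)) * emeasure M (cball z t)" by blast
    qed
    then show "z \<in> (\<Union>k. ?E k)" by (rule UN_I[OF UNIV_I])
  qed
qed

section \<open>Doubling and mean value inequalities\<close>

text \<open>Doubling is assumed only on \<open>[0, R]\<close> because the inverse of an admissible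
  function is known to double only near 0. The condition on \<open>2 ^ k * t\<close> keeps every
  argument of the iteration in that range.\<close>

lemma doubling_iterate:
  fixes f :: "real \<Rightarrow> real"
  assumes dbl: "\<And>t. 0 \<le> t \<Longrightarrow> t \<le> R \<Longrightarrow> f (2 * t) \<le> C * f t" and C: "0 \<le> C"
    and t: "0 \<le> t" "2 ^ k * t \<le> R"
  shows "f (2 ^ k * t) \<le> C ^ k * f t"
  using t(2)
proof (induction k)
  case (Suc k)
  have "0 \<le> 2 ^ k * t" using t(1) by simp
  then have le: "2 ^ k * t \<le> R" using Suc.prems by simp
  have "f (2 ^ Suc k * t) \<le> C * f (2 ^ k * t)"
    using dbl[OF \<open>0 \<le> 2 ^ k * t\<close> le] by (simp add: mult.assoc)
  also have "\<dots> \<le> C * (C ^ k * f t)"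
    using Suc.IH[OF le] C by (rule mult_left_mono)
  finally show ?case by (simp add: mult.assoc)
qed simp

lemma doubling_bound:
  fixes f :: "real \<Rightarrow> real"
  assumes "\<And>t. 0 \<le> t \<Longrightarrow> t \<le> R \<Longrightarrow> f (2 * t) \<le> C * f t" "0 \<le> C" "mono_on {0..} f"
    and "0 \<le> s" "0 \<le> t" "s \<le> 2 ^ k * t" "2 ^ k * t \<le> R"
  shows "f s \<le> C ^ k * f t"
proof -
  have "f s \<le> f (2 ^ k * t)"
    using assms(4-6) by (intro mono_onD[OF assms(3)]) auto
  also have "\<dots> \<le> C ^ k * f t"
    by (rule doubling_iterate[where f = f and R = R]) (use assms in auto)
  finally show ?thesis .
qed

text \<open>Trades the factor 2 for an arbitrary factor \<open>A\<close>: some power of 2 exceeds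
  \<open>A\<close>, and monotonicity covers the rest.\<close>

lemma delta2_condition_bound:
  assumes "delta2_condition f" "mono_on {0..} f"
  obtains K where "1 \<le> K" "\<And>s t. 0 \<le> s \<Longrightarrow> 0 \<le> t \<Longrightarrow> s \<le> A * t \<Longrightarrow> f s \<le> K * f t"
proof -
  obtain C where C: "1 \<le> C" "\<And>t. 0 \<le> t \<Longrightarrow> f (2 * t) \<le> C * f t"
    using assms(1) by (auto simp: delta2_condition_def)
  obtain k where k: "A < 2 ^ k" using real_arch_pow[of 2 A] by auto
  show ?thesis
  proof
    show "1 \<le> C ^ k" using C(1) by simp
    fix s t :: real assume st: "0 \<le> s" "0 \<le> t" "s \<le> A * t"
    have "A * t \<le> 2 ^ k * t" using k st(2) by (intro mult_right_mono) auto
    with st have le: "s \<le> 2 ^ k * t" by simp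
    show "f s \<le> C ^ k * f t"
      by (rule doubling_bound[where f = f and R = "2 ^ k * t"])
        (use C assms(2) st le in auto)
  qed
qed

lemma borel_measurable_mono_on_nonneg:
  fixes U :: "'a \<Rightarrow> real"
  assumes f: "mono_on {0..} f" and U: "U \<in> borel_measurable M" "\<And>x. 0 \<le> U x"
  shows "(\<lambda>x. f (U x) :: real) \<in> borel_measurable M"
proof -
  \<comment> \<open>Precomposing with \<open>max 0\<close> extends \<open>f\<close> from the
    half-line to a monotone function on all reals and leaves \<open>f (U x)\<close>
    unchanged.\<close>
  have "mono (\<lambda>t. f (max 0 t))"
    by (intro monoI mono_onD[OF f]) auto
  then have "(\<lambda>x. f (max 0 (U x))) \<in> borel_measurable M"
    by (rule measurable_compose[OF U(1) borel_measurable_mono])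
  then show ?thesis using U(2) by (simp add: max_absorb2)
qed

section \<open>Convex functions and averages\<close>

text \<open>A chord takes the place of the supporting line in Jensen's inequality. By convexity the
  line through the graph points at 0 and \<open>b\<close> lies below \<open>f\<close> beyond
  \<open>b\<close>. Before \<open>b\<close> the line is at most \<open>f b\<close>, and since
  \<open>f t\<close> is at least \<open>f 0\<close>, the error term \<open>f b - f 0\<close> makes
  up the difference.\<close>

lemma convex_mono_affine_bound:
  fixes f :: "real \<Rightarrow> real"
  assumes "mono_on {0..} f" "convex_on {0..} f" "0 < b" "0 \<le> t"
  shows "f 0 + (f b - f 0) / b * t \<le> f t + (f b - f 0)"
proof -
  have mono: "f 0 \<le> f b" "f 0 \<le> f t"
    using assms by (auto intro!: mono_onD[OF assms(1)])
  show ?thesis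
  proof (cases "t \<le> b")
    case True
    then have "(f b - f 0) / b * t \<le> (f b - f 0) / b * b"
      using mono assms(3) by (intro mult_left_mono divide_nonneg_pos) auto
    then show ?thesis using mono assms(3) by simp
  next
    case False
    have "f ((1 - b / t) *\<^sub>R 0 + (b / t) *\<^sub>R t) \<le> (1 - b / t) * f 0 + b / t * f t"
      using False assms(3) by (intro convex_onD[OF assms(2)]) auto
    then have "f b - f 0 \<le> b / t * (f t - f 0)"
      using False assms(3) by (simp add: algebra_simps)
    then have "(f b - f 0) / b * t \<le> f t - f 0"
      using False assms(3) by (simp add: field_simps)
    then show ?thesis using mono by simp
  qed
qed

lemma emeasure_lebesgue_ball:
  fixes x :: "'a::euclidean_space"
  assumes "0 < r"
  shows "emeasure lebesgue (ball x r) = ennreal (unit_ball_vol (real DIM('a)) * r ^ DIM('a))"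
  using assms by (simp add: emeasure_ball)

lemma borel_measurable_ennreal_ball:
  fixes V :: "'a::euclidean_space \<Rightarrow> real"
  assumes "V \<in> borel_measurable lebesgue"
  shows "(\<lambda>z. ennreal (V z) * indicator (ball x R) z) \<in> borel_measurable lebesgue"
  by (intro borel_measurable_times_ennreal measurable_compose[OF assms measurable_ennreal]
      borel_measurable_indicator) simp

text \<open>A one-sided Jensen inequality: \<open>b\<close> is at most half the average of \<open>U\<close>, so that integrating
  the affine bound above leaves exactly \<open>f b\<close>.\<close>

lemma convex_le_average:
  fixes f :: "real \<Rightarrow> real" and U :: "'a \<Rightarrow> real"
  assumes f: "f \<in> {0..} \<rightarrow> {0..}" "mono_on {0..} f" "convex_on {0..} f"
    and U[measurable]: "U \<in> borel_measurable M" and U0: "\<And>x. 0 \<le> U x"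
    and B[measurable]: "B \<in> sets M" and m: "emeasure M B = ennreal m" "0 \<le> m"
    and b: "0 \<le> b" "ennreal (2 * b * m) \<le> (\<integral>\<^sup>+y\<in>B. ennreal (U y) \<partial>M)"
  shows "ennreal (f b * m) \<le> (\<integral>\<^sup>+y\<in>B. ennreal (f (U y)) \<partial>M)"
proof -
  have fU[measurable]: "(\<lambda>y. f (U y)) \<in> borel_measurable M"
    by (rule borel_measurable_mono_on_nonneg[OF f(2) U U0])
  have f0: "0 \<le> f t" if "0 \<le> t" for t using f(1) that by auto
  have fmono: "f 0 \<le> f t" if "0 \<le> t" for t
    using that by (intro mono_onD[OF f(2)]) auto
  show ?thesis
  \<comment> \<open>At \<open>b = 0\<close> there is no chord; there \<open>f 0\<close> bounds
    \<open>f (U y)\<close> from below pointwise.\<close>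
  proof (cases "b = 0")
    case True
    have "ennreal (f b * m) = (\<integral>\<^sup>+y\<in>B. ennreal (f 0) \<partial>M)"
      using m f0[of 0] True by (simp add: nn_integral_cmult_indicator ennreal_mult)
    also have "\<dots> \<le> (\<integral>\<^sup>+y\<in>B. ennreal (f (U y)) \<partial>M)"
      using U0 fmono by (intro nn_integral_mono mult_right_mono ennreal_leI) auto
    finally show ?thesis .
  next
    case False
    then have "0 < b" using b(1) by simp
    define D where "D = f b - f 0"
    have D: "0 \<le> D" using fmono[OF b(1)] by (simp add: D_def)
    let ?F = "\<integral>\<^sup>+y\<in>B. ennreal (f (U y)) \<partial>M"
    show ?thesis
    proof (cases "?F = \<infinity>")
      case False
      then obtain F where F: "?F = ennreal F" "0 \<le> F"
        by (metis ennreal_cases infinity_ennreal_def)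
      have "ennreal (f 0 * m + 2 * D * m) = ennreal (f 0) * ennreal m + ennreal (D / b) * ennreal (2 * b * m)"
        using \<open>0 < b\<close> D f0[of 0] m(2) by (simp flip: ennreal_mult ennreal_plus)
      also have "\<dots> \<le> ennreal (f 0) * ennreal m + ennreal (D / b) * (\<integral>\<^sup>+y\<in>B. ennreal (U y) \<partial>M)"
        by (intro add_left_mono mult_left_mono b(2)) simp
      also have "\<dots> = (\<integral>\<^sup>+y. ennreal (f 0) * indicator B y + ennreal (D / b) * (ennreal (U y) * indicator B y) \<partial>M)"
        by (simp add: nn_integral_add nn_integral_cmult nn_integral_cmult_indicator m(1))
      also have "\<dots> \<le> (\<integral>\<^sup>+y. ennreal (f (U y)) * indicator B y + ennreal D * indicator B y \<partial>M)"
      proof (intro nn_integral_mono)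
        fix y
        have "f 0 + D / b * U y \<le> f (U y) + D"
          using convex_mono_affine_bound[OF f(2,3) \<open>0 < b\<close> U0] by (simp add: D_def)
        then have "ennreal (f 0) + ennreal (D / b) * ennreal (U y) \<le> ennreal (f (U y)) + ennreal D"
          using f0[of 0] f0[OF U0] U0[of y] D \<open>0 < b\<close>
          by (simp flip: ennreal_mult ennreal_plus)
        then show "ennreal (f 0) * indicator B y + ennreal (D / b) * (ennreal (U y) * indicator B y)
            \<le> ennreal (f (U y)) * indicator B y + ennreal D * indicator B y"
          by (simp add: indicator_def)
      qed
      also have "\<dots> = ?F + ennreal D * ennreal m"
        by (simp add: nn_integral_add nn_integral_cmult_indicator m(1))
      also have "\<dots> = ennreal (F + D * m)"
        using F D m(2) by (simp flip: ennreal_mult ennreal_plus)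
      finally have "f 0 * m + 2 * D * m \<le> F + D * m"
        using F(2) D m(2) by (subst (asm) ennreal_le_iff) auto
      then have "f b * m \<le> F" by (simp add: D_def algebra_simps)
      then show ?thesis using F by simp
    qed simp
  qed
qed

section \<open>Mean value inequalities on single balls\<close>

text \<open>The division by the power of \<open>r\<close> is cleared and values are taken in
  \<open>ennreal\<close>, so for positive \<open>C\<close> an infinite integral makes the inequality
  trivially true. Fixing one ball lets the lemmas below say exactly on which balls they use the
  inequality.\<close>

definition submean :: "real \<Rightarrow> ('a::euclidean_space \<Rightarrow> real) \<Rightarrow> 'a \<Rightarrow> real \<Rightarrow> bool" where
  "submean C V x r \<longleftrightarrow>
     ennreal (V x * r ^ DIM('a)) \<le> ennreal C * (\<integral>\<^sup>+y\<in>ball x r. ennreal (V y) \<partial>lebesgue)"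

text \<open>Jensen controls \<open>f\<close> at a fixed fraction of \<open>U x\<close>, and the
  doubling condition leads back from there to \<open>f (U x)\<close>. The new constant is chosen
  before \<open>U\<close>, \<open>x\<close> and \<open>r\<close>, so it serves all balls at
  once.\<close>

lemma submean_convex:
  fixes f :: "real \<Rightarrow> real" and C :: real
  assumes f: "f \<in> {0..} \<rightarrow> {0..}" "mono_on {0..} f" "convex_on {0..} f" "delta2_condition f"
    and C: "0 < C"
  shows "\<exists>C'>0. \<forall>(U :: 'a::euclidean_space \<Rightarrow> real) x r. U \<in> borel_measurable lebesgue \<longrightarrow> (\<forall>y. 0 \<le> U y) \<longrightarrow>
      0 < r \<longrightarrow> submean C U x r \<longrightarrow> submean C' (\<lambda>y. f (U y)) x r"
proof -
  define \<omega> where "\<omega> = unit_ball_vol (real DIM('a))"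
  have \<omega>: "0 < \<omega>" by (simp add: \<omega>_def)
  obtain K where K: "1 \<le> K" "\<And>s t. 0 \<le> s \<Longrightarrow> 0 \<le> t \<Longrightarrow> s \<le> (2 * C * \<omega>) * t \<Longrightarrow> f s \<le> K * f t"
    using delta2_condition_bound[OF f(4,2)] by blast
  show ?thesis
  proof (intro exI[of _ "K / \<omega>"] conjI allI impI)
    show "0 < K / \<omega>" using K(1) \<omega> by simp
    fix U :: "'a \<Rightarrow> real" and x :: 'a and r :: real
    assume U: "U \<in> borel_measurable lebesgue" and "\<forall>y. 0 \<le> U y" and r: "0 < r"
      and mv: "submean C U x r"
    then have U0: "0 \<le> U y" for y by blast
    have m: "emeasure lebesgue (ball x r) = ennreal (\<omega> * r ^ DIM('a))"
      unfolding \<omega>_def by (rule emeasure_lebesgue_ball[OF r])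
    \<comment> \<open>The hypothesis makes the average of \<open>U\<close> at least
      \<open>U x / (C * \<omega>)\<close>; \<open>b\<close> is half of this, as
      \<open>convex_le_average\<close> requires.\<close>
    define b where "b = U x / (2 * C * \<omega>)"
    have b: "0 \<le> b" "U x = 2 * C * \<omega> * b" using U0[of x] C \<omega> by (simp_all add: b_def)
    have fb: "0 \<le> f b" using f(1) b(1) by auto
    have "ennreal (2 * b * (\<omega> * r ^ DIM('a))) = ennreal (1 / C) * ennreal (U x * r ^ DIM('a))"
      using b C \<omega> r by (simp add: field_simps flip: ennreal_mult)
    also have "\<dots> \<le> ennreal (1 / C) * (ennreal C * (\<integral>\<^sup>+y\<in>ball x r. ennreal (U y) \<partial>lebesgue))"
      by (intro mult_left_mono mv[unfolded submean_def]) simp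
    also have "\<dots> = (\<integral>\<^sup>+y\<in>ball x r. ennreal (U y) \<partial>lebesgue)"
      using C by (simp add: mult.assoc[symmetric] flip: ennreal_mult)
    finally have "ennreal (2 * b * (\<omega> * r ^ DIM('a))) \<le> (\<integral>\<^sup>+y\<in>ball x r. ennreal (U y) \<partial>lebesgue)" .
    then have avg: "ennreal (f b * (\<omega> * r ^ DIM('a))) \<le> (\<integral>\<^sup>+y\<in>ball x r. ennreal (f (U y)) \<partial>lebesgue)"
      using r \<omega> b(1) by (intro convex_le_average[OF f(1-3) U U0 _ m]) simp_all
    have "f (U x) \<le> K * f b" using b(2) by (intro K(2) U0 b(1)) simp
    then have "f (U x) * r ^ DIM('a) \<le> K * f b * r ^ DIM('a)"
      using r by (intro mult_right_mono) auto
    then have "ennreal (f (U x) * r ^ DIM('a)) \<le> ennreal (K * f b * r ^ DIM('a))"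
      by (rule ennreal_leI)
    also have "\<dots> = ennreal (K / \<omega>) * ennreal (f b * (\<omega> * r ^ DIM('a)))"
      using K(1) fb \<omega> r by (simp flip: ennreal_mult)
    also have "\<dots> \<le> ennreal (K / \<omega>) * (\<integral>\<^sup>+y\<in>ball x r. ennreal (f (U y)) \<partial>lebesgue)"
      by (intro mult_left_mono avg) simp
    finally show "submean (K / \<omega>) (\<lambda>y. f (U y)) x r" unfolding submean_def .
  qed
qed

section \<open>Increasing bijections of the half-line and mean values\<close>

lemma strict_mono_surj_zero:
  fixes g :: "real \<Rightarrow> real"
  assumes "strict_mono_on {0..} g" "g ` {0..} = {0..}"
  shows "g 0 = 0"
proof -
  obtain a where a: "0 \<le> a" "g a = 0" using assms(2) by (metis atLeast_iff imageE order_refl)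
  have "g 0 \<le> g a"
    using a(1) by (intro mono_onD[OF strict_mono_on_imp_mono_on[OF assms(1)]]) auto
  moreover have "0 \<le> g 0" using assms(2) by (metis atLeast_iff imageI order_refl)
  ultimately show ?thesis using a by simp
qed

lemma inv_into_strict_mono_on:
  fixes g :: "real \<Rightarrow> real"
  assumes "strict_mono_on {0..} g" "g ` {0..} = {0..}"
  shows "\<And>t. 0 \<le> t \<Longrightarrow> inv_into {0..} g (g t) = t"
    "\<And>s. 0 \<le> s \<Longrightarrow> g (inv_into {0..} g s) = s"
    "\<And>s. 0 \<le> s \<Longrightarrow> 0 \<le> inv_into {0..} g s"
    "strict_mono_on {0..} (inv_into {0..} g)"
    "inv_into {0..} g 0 = 0"
proof -
  have inj: "inj_on g {0..}" using assms(1) by (rule strict_mono_on_imp_inj_on)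
  show 1: "\<And>t. 0 \<le> t \<Longrightarrow> inv_into {0..} g (g t) = t"
    using inj by simp
  show 2: "\<And>s. 0 \<le> s \<Longrightarrow> g (inv_into {0..} g s) = s"
    using assms(2) by (intro f_inv_into_f) auto
  show 3: "0 \<le> inv_into {0..} g s" if "0 \<le> s" for s
    using inv_into_into[of s g "{0..}"] assms(2) that by auto
  show "strict_mono_on {0..} (inv_into {0..} g)"
  proof (rule strict_mono_onI)
    fix r s :: real assume rs: "r \<in> {0..}" "s \<in> {0..}" "r < s"
    show "inv_into {0..} g r < inv_into {0..} g s"
    proof (rule ccontr)
      assume "\<not> ?thesis"
      then have "g (inv_into {0..} g s) \<le> g (inv_into {0..} g r)"
        using rs 3 by (intro mono_onD[OF strict_mono_on_imp_mono_on[OF assms(1)]]) auto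
      then show False using rs 2 by simp
    qed
  qed
  show "inv_into {0..} g 0 = 0"
    using 1[of 0] strict_mono_surj_zero[OF assms] by simp
qed

text \<open>Fefferman and Stein's argument for powers below 1: the mean value inequality for \<open>V\<close> is used
  only at a near-maximiser \<open>y\<close> of \<open>(R - |y - x|)\<^sup>n g(V y)\<close>, on a ball around which \<open>V\<close> is at most a
  constant multiple of \<open>V y\<close>. Boundedness makes the supremum finite; the bound does not enter
  \<open>C'\<close>.\<close>

lemma submean_quasi_increasing:
  fixes g :: "real \<Rightarrow> real" and C :: real
  assumes g: "strict_mono_on {0..} g" "g ` {0..} = {0..}"
    and inv: "delta2_condition (inv_into {0..} g)"
    and quasi: "0 < Q" "\<And>s t. 0 < s \<Longrightarrow> s \<le> t \<Longrightarrow> s / g s \<le> Q * (t / g t)"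
    and C: "0 < C"
  shows "\<exists>C'>0. \<forall>(V :: 'a::euclidean_space \<Rightarrow> real) x R B. V \<in> borel_measurable lebesgue \<longrightarrow> (\<forall>y. 0 \<le> V y) \<longrightarrow>
      0 < R \<longrightarrow> (\<forall>y\<in>ball x R. V y \<le> B) \<longrightarrow>
      (\<forall>y s. 0 < s \<longrightarrow> ball y s \<subseteq> ball x R \<longrightarrow> submean C V y s) \<longrightarrow> submean C' (\<lambda>y. g (V y)) x R"
proof -
  let ?n = "DIM('a)"
  let ?h = "inv_into {0..} g"
  note h = inv_into_strict_mono_on[OF g]
  have gmono: "g s \<le> g t" if "0 \<le> s" "s \<le> t" for s t
    using that by (intro mono_onD[OF strict_mono_on_imp_mono_on[OF g(1)]]) auto
  have g0: "g 0 = 0" by (rule strict_mono_surj_zero[OF g])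
  have gnn: "0 \<le> g t" if "0 \<le> t" for t using gmono[of 0 t] g0 that by simp
  have gpos: "0 < g t" if "0 < t" for t
    using strict_mono_onD[OF g(1), of 0 t] g0 that by simp
  \<comment> \<open>Near-maximality will bound \<open>g (V z)\<close> by
    \<open>2 ^ Suc ?n * g (V y)\<close>; \<open>K\<close> turns this into
    \<open>V z \<le> K * V y\<close>.\<close>
  obtain K where K: "1 \<le> K" "\<And>s t. 0 \<le> s \<Longrightarrow> 0 \<le> t \<Longrightarrow> s \<le> 2 ^ Suc ?n * t \<Longrightarrow> ?h s \<le> K * ?h t"
    using delta2_condition_bound[OF inv strict_mono_on_imp_mono_on[OF h(4)]] by blast
  \<comment> \<open>One factor 2 pays for the near-maximiser, the other \<open>?n\<close> factors
    for halving the distance from \<open>y\<close> to the sphere.\<close>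
  define C' where "C' = 2 ^ Suc ?n * (C * Q * K)"
  show ?thesis
  proof (intro exI[of _ C'] conjI allI impI)
    show "0 < C'" using C quasi K by (simp add: C'_def)
    fix V :: "'a \<Rightarrow> real" and x :: 'a and R B :: real
    assume "V \<in> borel_measurable lebesgue" and "\<forall>y. 0 \<le> V y" and R: "0 < R"
      and "\<forall>y\<in>ball x R. V y \<le> B"
      and mv: "\<forall>y s. 0 < s \<longrightarrow> ball y s \<subseteq> ball x R \<longrightarrow> submean C V y s"
    then have V: "V \<in> borel_measurable lebesgue" "\<And>y. 0 \<le> V y"
      and bdd: "\<And>y. y \<in> ball x R \<Longrightarrow> V y \<le> B" by blast+
    let ?I = "\<integral>\<^sup>+z\<in>ball x R. ennreal (g (V z)) \<partial>lebesgue"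
    have gV[measurable]: "(\<lambda>z. g (V z)) \<in> borel_measurable lebesgue"
      by (rule borel_measurable_mono_on_nonneg[OF strict_mono_on_imp_mono_on[OF g(1)] V])
    have goal: "ennreal (g (V x) * R ^ ?n) \<le> ennreal C' * ennreal W" if W: "?I = ennreal W" "0 \<le> W" for W
    proof (cases "V x = 0")
      case True
      then show ?thesis using g0 by simp
    next
      case False
      define F where "F y = (R - dist x y) ^ ?n * g (V y)" for y
      have Fbdd: "F y \<le> R ^ ?n * g B" if "y \<in> ball x R" for y
        unfolding F_def using that R V(2)[of y] bdd[OF that] gnn[of "V y"]
        by (intro mult_mono power_mono gmono) auto
      have bddF: "bdd_above (F ` ball x R)" using Fbdd by (rule bdd_aboveI2)
      define S where "S = (SUP y\<in>ball x R. F y)"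
      have FS: "F y \<le> S" if "y \<in> ball x R" for y
        unfolding S_def by (rule cSUP_upper[OF that bddF])
      have "0 < F x" using V(2)[of x] False R gpos[of "V x"] by (simp add: F_def)
      moreover have "F x \<le> S" using R by (intro FS) simp
      ultimately have "S / 2 < S" by simp
      then obtain y where y: "y \<in> ball x R" "S / 2 < F y"
        unfolding S_def using R bddF by (subst (asm) less_cSUP_iff) auto
      \<comment> \<open>Half the distance from \<open>y\<close> to the sphere: points of
        \<open>ball y s\<close> keep distance at least \<open>s\<close> from the sphere, so the
        weights there and at \<open>y\<close> compare up to \<open>2 ^ ?n\<close>.\<close>
      define s where "s = (R - dist x y) / 2"
      have s: "0 < s" using y(1) by (simp add: s_def)
      have "0 < F y" using y(2) \<open>0 < F x\<close> \<open>F x \<le> S\<close> by simp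
      then have "V y \<noteq> 0" using g0 by (auto simp: F_def)
      then have Vy: "0 < V y" using V(2)[of y] by simp
      then have gVy: "0 < g (V y)" by (rule gpos)
      have sub: "ball y s \<subseteq> ball x R"
      proof
        fix z assume "z \<in> ball y s"
        then show "z \<in> ball x R"
          using dist_triangle[of x z y] s y(1) by (simp add: s_def)
      qed
      have Fy: "F y = 2 ^ ?n * (s ^ ?n * g (V y))"
        by (simp add: F_def s_def power_divide)
      define M where "M = K * V y"
      have Vz: "V z \<le> M" if z: "z \<in> ball y s" for z
      proof -
        have "s \<le> R - dist x z"
          using z dist_triangle[of x z y] by (simp add: s_def)
        then have "s ^ ?n * g (V z) \<le> F z"
          unfolding F_def using s gnn[OF V(2)] by (intro mult_right_mono power_mono) auto
        also have "\<dots> \<le> 2 * F y" using FS[of z] y(2) sub z by force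
        also have "\<dots> = s ^ ?n * (2 ^ Suc ?n * g (V y))" by (simp add: Fy)
        finally have "g (V z) \<le> 2 ^ Suc ?n * g (V y)" using s by simp
        then have "?h (g (V z)) \<le> K * ?h (g (V y))"
          using gnn V(2) by (intro K(2)) auto
        then show ?thesis using h(1) V(2) by (simp add: M_def)
      qed
      have M: "V y \<le> M" "0 < M" using K(1) Vy by (simp_all add: M_def)
      \<comment> \<open>Quasi-monotonicity of \<open>t / g t\<close> between \<open>V z\<close> and
        \<open>M\<close> bounds \<open>V z / g (V z)\<close> by \<open>Q * (M / g M)\<close>, and
        replacing \<open>g M\<close> by the smaller \<open>g (V y)\<close> gives \<open>c\<close>.
        Thus \<open>V\<close> is dominated on \<open>ball y s\<close> by a multiple of
        \<open>g (V z)\<close>.\<close>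
      define c where "c = Q * K * V y / g (V y)"
      have c: "0 \<le> c" using quasi(1) K(1) Vy gVy by (simp add: c_def)
      have Vc: "V z \<le> c * g (V z)" if z: "z \<in> ball y s" for z
      proof (cases "V z = 0")
        case True
        then show ?thesis using g0 by simp
      next
        case False
        then have "0 < V z" using V(2)[of z] by simp
        then have "V z / g (V z) \<le> Q * (M / g M)" using Vz[OF z] by (rule quasi(2))
        also have "\<dots> \<le> Q * (M / g (V y))"
          using M gmono[OF _ M(1)] gVy quasi(1) Vy
          by (intro mult_left_mono divide_left_mono) auto
        also have "\<dots> = c" by (simp add: c_def M_def)
        finally show ?thesis using gpos[OF \<open>0 < V z\<close>] by (simp add: field_simps)
      qed
      have "ennreal (V y * s ^ ?n) \<le> ennreal C * (\<integral>\<^sup>+z\<in>ball y s. ennreal (V z) \<partial>lebesgue)"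
        using mv s sub unfolding submean_def by blast
      also have "\<dots> \<le> ennreal C * (\<integral>\<^sup>+z. ennreal c * (ennreal (g (V z)) * indicator (ball x R) z) \<partial>lebesgue)"
      proof (intro mult_left_mono nn_integral_mono)
        fix z
        show "ennreal (V z) * indicator (ball y s) z \<le> ennreal c * (ennreal (g (V z)) * indicator (ball x R) z)"
        proof (cases "z \<in> ball y s")
          case True
          then have "z \<in> ball x R" using sub by blast
          then show ?thesis
            using True ennreal_leI[OF Vc[OF True]] c gnn[OF V(2)] by (simp add: ennreal_mult)
        qed simp
      qed simp
      also have "\<dots> = ennreal C * (ennreal c * ennreal W)"
        by (subst nn_integral_cmult[OF borel_measurable_ennreal_ball[OF gV]]) (simp add: W)
      also have "\<dots> = ennreal (C * (c * W))"
        using C c W(2) by (simp add: ennreal_mult)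
      finally have "V y * s ^ ?n \<le> C * (c * W)"
        using C c W(2) by (subst (asm) ennreal_le_iff) auto
      \<comment> \<open>The factor \<open>V y\<close> hidden in \<open>c\<close> cancels against the
        left side and leaves a bound for \<open>g (V y)\<close> itself.\<close>
      also have "\<dots> = V y * (C * Q * K * W / g (V y))" by (simp add: c_def)
      finally have "s ^ ?n * g (V y) \<le> C * Q * K * W"
        using Vy gVy by (simp add: field_simps)
      then have "2 * F y \<le> C' * W"
        unfolding Fy C'_def by simp
      moreover have "F x \<le> 2 * F y" using \<open>F x \<le> S\<close> y(2) by simp
      moreover have "F x = g (V x) * R ^ ?n" by (simp add: F_def)
      ultimately have "g (V x) * R ^ ?n \<le> C' * W" by simp
      then show ?thesis using \<open>0 < C'\<close> W(2) by (simp add: ennreal_leI flip: ennreal_mult)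
    qed
    show "submean C' (\<lambda>y. g (V y)) x R"
    proof (cases "?I = \<infinity>")
      case True
      then show ?thesis using \<open>0 < C'\<close> by (simp add: submean_def ennreal_mult_top)
    next
      case False
      then obtain W where "?I = ennreal W" "0 \<le> W" by (metis ennreal_cases infinity_ennreal_def)
      then show ?thesis using goal by (simp add: submean_def)
    qed
  qed
qed

section \<open>From \<open>u\<close> to a mean value inequality for
  \<open>\<psi> (U x)\<close>\<close>

text \<open>On \<open>\<Omega>\<close> the function \<open>u\<close> is finite and has no negative
  part, so the extended-real integrals reduce to nonnegative integrals of \<open>U\<close>.
  Extension by 0 turns measurability on \<open>\<Omega>\<close> into measurability on the whole
  space.\<close>

lemma quasi_nearly_subharmonic_nonnegD:
  fixes \<Omega> :: "'a::euclidean_space set" and u :: "'a \<Rightarrow> ereal"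
  assumes qns: "quasi_nearly_subharmonic \<Omega> u" and op: "open \<Omega>" and u0: "\<forall>x\<in>\<Omega>. 0 \<le> u x"
    and U_def: "U = (\<lambda>x. if x \<in> \<Omega> then real_of_ereal (u x) else 0)"
  shows "U \<in> borel_measurable lebesgue"
    and "\<And>x. 0 \<le> U x"
    and "\<And>K. compact K \<Longrightarrow> K \<subseteq> \<Omega> \<Longrightarrow> (\<integral>\<^sup>+y\<in>K. ennreal (U y) \<partial>lebesgue) < \<infinity>"
    and "\<exists>C>0. \<forall>x r. 0 < r \<longrightarrow> ball x r \<subseteq> \<Omega> \<longrightarrow> submean C U x r"
proof -
  have uU: "u y = ereal (U y)" if "y \<in> \<Omega>" for y
    using quasi_nearly_subharmonic_nonneg_finite[OF qns op that u0] that
    by (simp add: U_def ereal_real)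
  have loc: "locally_integrable \<Omega> u"
    and "\<exists>C\<ge>1. \<forall>x r. 0 < r \<and> ball x r \<subseteq> \<Omega> \<longrightarrow>
        u x \<le> ereal (C / r ^ DIM('a)) * ereal_lebesgue_integral (ball x r) u"
    using qns by (simp_all only: quasi_nearly_subharmonic_def)
  then obtain C where C: "1 \<le> C" "\<And>x r. 0 < r \<Longrightarrow> ball x r \<subseteq> \<Omega> \<Longrightarrow>
        u x \<le> ereal (C / r ^ DIM('a)) * ereal_lebesgue_integral (ball x r) u"
    by metis
  show U0: "0 \<le> U x" for x
    using u0 by (simp add: U_def real_of_ereal_pos)
  have e: "e2ennreal (u y) = ennreal (U y)" "e2ennreal \<bar>u y\<bar> = ennreal (U y)" if "y \<in> \<Omega>" for y
    using uU[OF that] U0[of y] by simp_all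
  have "(\<lambda>x. real_of_ereal (u x)) \<in> borel_measurable (lebesgue_on \<Omega>)"
    using loc by (intro borel_measurable_real_of_ereal) (simp add: locally_integrable_def)
  moreover have "\<Omega> \<inter> space lebesgue \<in> sets lebesgue"
    using op by simp
  ultimately show "U \<in> borel_measurable lebesgue"
    unfolding U_def by (subst (asm) measurable_restrict_space_iff[of \<Omega> lebesgue 0]) auto
  show "(\<integral>\<^sup>+y\<in>K. ennreal (U y) \<partial>lebesgue) < \<infinity>" if K: "compact K" "K \<subseteq> \<Omega>" for K
  proof -
    have "(\<integral>\<^sup>+y\<in>K. ennreal (U y) \<partial>lebesgue) = (\<integral>\<^sup>+y\<in>K. e2ennreal \<bar>u y\<bar> \<partial>lebesgue)"
      using K(2) e(2) by (intro nn_integral_cong) (auto simp: indicator_def)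
    also have "\<dots> < \<infinity>" using loc K by (simp add: locally_integrable_def)
    finally show ?thesis .
  qed
  show "\<exists>C>0. \<forall>x r. 0 < r \<longrightarrow> ball x r \<subseteq> \<Omega> \<longrightarrow> submean C U x r"
  proof (intro exI[of _ C] conjI allI impI)
    show "0 < C" using C(1) by simp
    fix x r assume r: "(0::real) < r" and sub: "ball x r \<subseteq> \<Omega>"
    let ?I = "\<integral>\<^sup>+y\<in>ball x r. ennreal (U y) \<partial>lebesgue"
    have x: "x \<in> \<Omega>" using sub r by auto
    have I: "(\<integral>\<^sup>+y\<in>ball x r. e2ennreal (u y) \<partial>lebesgue) = ?I"
      using sub e(1) by (intro nn_integral_cong) (auto simp: indicator_def)
    have J: "(\<integral>\<^sup>+y\<in>ball x r. e2ennreal (- u y) \<partial>lebesgue) = (\<integral>\<^sup>+(y::'a). (0::ennreal) \<partial>lebesgue)"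
      using sub u0 by (intro nn_integral_cong) (auto simp: indicator_def e2ennreal_neg)
    show "submean C U x r"
    proof (cases "?I = \<infinity>")
      case True
      then show ?thesis using C(1) by (simp add: submean_def ennreal_mult_top)
    next
      case False
      then obtain c where c: "?I = ennreal c" "0 \<le> c" by (metis ennreal_cases infinity_ennreal_def)
      have "ereal_lebesgue_integral (ball x r) u = ereal c"
        unfolding ereal_lebesgue_integral_def I J c(1)
        using c(2) by (simp add: zero_ennreal.rep_eq)
      then have "ereal (U x) \<le> ereal (C / r ^ DIM('a) * c)"
        using C(2)[OF r sub] uU[OF x] by simp
      then have "U x * r ^ DIM('a) \<le> C * c"
        using r by (simp add: field_simps)
      then show ?thesis
        using C(1) c by (simp add: submean_def ennreal_leI flip: ennreal_mult)
    qed
  qed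
qed

text \<open>The convex factor is handled first, then the quasi-increasing one. The second step asks
  for boundedness on \<open>ball x R\<close>; this is why the ball of twice the radius must lie in
  \<open>\<Omega>\<close>.\<close>

lemma submean_permissible:
  fixes \<Omega> :: "'a::euclidean_space set" and u :: "'a \<Rightarrow> ereal"
  assumes qns: "quasi_nearly_subharmonic \<Omega> u" "open \<Omega>" "\<forall>x\<in>\<Omega>. 0 \<le> u x"
    and perm: "permissible \<psi>"
    and U_def: "U = (\<lambda>x. if x \<in> \<Omega> then real_of_ereal (u x) else 0)"
  shows "(\<lambda>x. \<psi> (U x)) \<in> borel_measurable lebesgue"
    and "\<And>x. 0 \<le> \<psi> (U x)"
    and "\<exists>C>0. \<forall>x R. 0 < R \<longrightarrow> cball x (2 * R) \<subseteq> \<Omega> \<longrightarrow> submean C (\<lambda>y. \<psi> (U y)) x R"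
proof -
  note U = quasi_nearly_subharmonic_nonnegD[OF qns U_def]
  obtain f g Q where f: "f \<in> {0..} \<rightarrow> {0..}" "mono_on {0..} f" "convex_on {0..} f"
      "delta2_condition f"
    and g: "strict_mono_on {0..} g" "g ` {0..} = {0..}" "delta2_condition (inv_into {0..} g)"
    and \<psi>: "\<And>t. 0 \<le> t \<Longrightarrow> \<psi> t = g (f t)"
    and Q: "1 \<le> Q" "\<And>s t. 0 < s \<Longrightarrow> s \<le> t \<Longrightarrow> s / g s \<le> Q * (t / g t)"
    using perm unfolding permissible_def by metis
  define V where "V x = f (U x)" for x
  have V: "V \<in> borel_measurable lebesgue" "\<And>y. 0 \<le> V y"
    unfolding V_def using f(1) U(2)
    by (auto intro!: borel_measurable_mono_on_nonneg[OF f(2) U(1,2)])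
  have \<psi>V: "\<psi> (U x) = g (V x)" for x using \<psi>[OF U(2)] by (simp add: V_def)
  show "(\<lambda>x. \<psi> (U x)) \<in> borel_measurable lebesgue"
    unfolding \<psi>V
    by (rule borel_measurable_mono_on_nonneg[OF strict_mono_on_imp_mono_on[OF g(1)] V])
  show "0 \<le> \<psi> (U x)" for x
    unfolding \<psi>V using g(2) V(2)[of x] by (metis atLeast_iff imageI)
  obtain C where C: "0 < C" "\<And>x r. 0 < r \<Longrightarrow> ball x r \<subseteq> \<Omega> \<Longrightarrow> submean C U x r"
    using U(4) by blast
  obtain C1 where C1: "0 < C1" "\<forall>(U :: 'a \<Rightarrow> real) x r. U \<in> borel_measurable lebesgue \<longrightarrow>
      (\<forall>y. 0 \<le> U y) \<longrightarrow> 0 < r \<longrightarrow> submean C U x r \<longrightarrow> submean C1 (\<lambda>y. f (U y)) x r"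
    using submean_convex[OF f C(1)] by blast
  have Q0: "0 < Q" using Q(1) by simp
  obtain C2 where C2: "0 < C2" "\<forall>(V :: 'a \<Rightarrow> real) x R B. V \<in> borel_measurable lebesgue \<longrightarrow>
      (\<forall>y. 0 \<le> V y) \<longrightarrow> 0 < R \<longrightarrow> (\<forall>y\<in>ball x R. V y \<le> B) \<longrightarrow>
      (\<forall>y s. 0 < s \<longrightarrow> ball y s \<subseteq> ball x R \<longrightarrow> submean C1 V y s) \<longrightarrow> submean C2 (\<lambda>y. g (V y)) x R"
    using submean_quasi_increasing[OF g Q0 Q(2) C1(1)] by blast
  show "\<exists>C>0. \<forall>x R. 0 < R \<longrightarrow> cball x (2 * R) \<subseteq> \<Omega> \<longrightarrow> submean C (\<lambda>y. \<psi> (U y)) x R"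
  proof (intro exI[of _ C2] conjI C2(1) allI impI)
    fix x :: 'a and R :: real assume R: "0 < R" and sub: "cball x (2 * R) \<subseteq> \<Omega>"
    obtain c where c: "(\<integral>\<^sup>+y\<in>cball x (2 * R). ennreal (U y) \<partial>lebesgue) = ennreal c" "0 \<le> c"
      using U(3)[OF compact_cball sub] ennreal_cases by (auto simp: less_top_ennreal)
    \<comment> \<open>The mean value inequality on \<open>ball y R\<close> is estimated by the
      integral over the compact ball of radius \<open>2 * R\<close>, which local integrability makes
      finite.\<close>
    have Ubdd: "U y \<le> C * c / R ^ DIM('a)" if y: "y \<in> ball x R" for y
    proof -
      have ysub: "ball y R \<subseteq> cball x (2 * R)"
      proof
        fix z assume "z \<in> ball y R"
        then show "z \<in> cball x (2 * R)"
          using y dist_triangle[of x z y] by simp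
      qed
      have "ennreal (U y * R ^ DIM('a)) \<le> ennreal C * (\<integral>\<^sup>+z\<in>ball y R. ennreal (U z) \<partial>lebesgue)"
        unfolding submean_def[symmetric] using ysub sub by (intro C(2) R) blast
      also have "\<dots> \<le> ennreal C * (\<integral>\<^sup>+z\<in>cball x (2 * R). ennreal (U z) \<partial>lebesgue)"
        using ysub by (intro mult_left_mono nn_integral_mono) (auto simp: indicator_def)
      also have "\<dots> = ennreal (C * c)" using C(1) c by (simp add: ennreal_mult)
      finally have "U y * R ^ DIM('a) \<le> C * c"
        using C(1) c(2) by (subst (asm) ennreal_le_iff) auto
      then show ?thesis using R by (simp add: field_simps)
    qed
    have "submean C2 (\<lambda>y. g (V y)) x R"
    proof (intro C2(2)[rule_format] V R)
      show "V y \<le> f (C * c / R ^ DIM('a))" if "y \<in> ball x R" for y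
        unfolding V_def using Ubdd[OF that] U(2)[of y] by (intro mono_onD[OF f(2)]) auto
      fix y s assume s: "(0::real) < s" and ys: "ball y s \<subseteq> ball x R"
      have "ball x R \<subseteq> cball x (2 * R)" using R by auto
      then have "ball y s \<subseteq> \<Omega>" using ys sub by blast
      then show "submean C1 V y s"
        unfolding V_def by (intro C1(2)[rule_format] U(1,2) s C(2))
    qed
    then show "submean C2 (\<lambda>y. \<psi> (U y)) x R"
      unfolding \<psi>V .
  qed
qed

section \<open>Growth near the boundary\<close>

lemma boundary_dist_pos:
  assumes "open \<Omega>" "x \<in> \<Omega>" "frontier \<Omega> \<noteq> {}"
  shows "0 < boundary_dist \<Omega> x"
  using assms infdist_pos_not_in_closed[OF frontier_closed assms(3), of x]
  by (auto simp: boundary_dist_def frontier_def interior_open)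

lemma borel_measurable_boundary_dist:
  fixes \<Omega> :: "'a::euclidean_space set"
  shows "boundary_dist \<Omega> \<in> borel_measurable lebesgue"
proof -
  have "continuous_on UNIV (boundary_dist \<Omega>)"
    unfolding boundary_dist_def by (intro continuous_intros)
  then have "boundary_dist \<Omega> \<in> borel_measurable lborel"
    using borel_measurable_continuous_onI by simp
  then show ?thesis by (rule measurable_completion)
qed

text \<open>A ball is connected, so one that meets \<open>\<Omega>\<close> and leaves it would
  contain a frontier point closer to \<open>x\<close> than the distance allows.\<close>

lemma ball_boundary_dist_subset:
  fixes \<Omega> :: "'a::real_normed_vector set"
  assumes "x \<in> \<Omega>"
  shows "ball x (boundary_dist \<Omega> x) \<subseteq> \<Omega>"
proof (rule ccontr)
  assume *: "\<not> ?thesis"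
  then have "0 < boundary_dist \<Omega> x" by (metis ball_empty empty_subsetI not_le)
  then have "x \<in> ball x (boundary_dist \<Omega> x) \<inter> \<Omega>" using assms by simp
  then have "ball x (boundary_dist \<Omega> x) \<inter> frontier \<Omega> \<noteq> {}"
    using * connected_Int_frontier[OF connected_ball] by blast
  then show False
    using infdist_le[of _ "frontier \<Omega>" x] by (fastforce simp: boundary_dist_def)
qed

lemma powr_comparable:
  fixes a b :: real
  assumes "0 < a" "0 < b" "a \<le> 2 * b" "b \<le> 2 * a"
  shows "a powr \<gamma> \<le> 2 powr \<bar>\<gamma>\<bar> * b powr \<gamma>"
proof (cases "0 \<le> \<gamma>")
  case True
  then have "a powr \<gamma> \<le> (2 * b) powr \<gamma>" using assms by (intro powr_mono2) auto
  then show ?thesis using True assms by (simp add: powr_mult)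
next
  case False
  then have "(2 * a) powr \<gamma> \<le> b powr \<gamma>" using assms by (intro powr_mono2') auto
  then show ?thesis using False assms by (simp add: powr_mult powr_minus field_simps)
qed

text \<open>On the ball of radius \<open>boundary_dist \<Omega> x / 3\<close> the boundary distance
  stays between 2/3 and 4/3 of its value at \<open>x\<close>, so the weight moves inside the
  integral at the cost of \<open>2 powr \<bar>\<gamma>\<bar>\<close>. The ball of twice that radius
  still lies in \<open>\<Omega>\<close>.\<close>

lemma weighted_mean_value:
  fixes \<Omega> :: "'a::euclidean_space set" and u :: "'a \<Rightarrow> ereal"
  assumes qns: "quasi_nearly_subharmonic \<Omega> u" "open \<Omega>" "\<forall>x\<in>\<Omega>. 0 \<le> u x"
    and perm: "permissible \<psi>" and fr: "frontier \<Omega> \<noteq> {}"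
    and w_def: "w = (\<lambda>x. \<psi> (if x \<in> \<Omega> then real_of_ereal (u x) else 0))"
  shows "\<exists>C>0. \<forall>x\<in>\<Omega>. ennreal (boundary_dist \<Omega> x powr (real DIM('a) + \<gamma>) * w x) \<le>
      ennreal C * (\<integral>\<^sup>+y\<in>ball x (boundary_dist \<Omega> x / 3). ennreal (w y * boundary_dist \<Omega> y powr \<gamma>) \<partial>lebesgue)"
proof -
  let ?n = "DIM('a)" and ?\<delta> = "boundary_dist \<Omega>"
  define U where "U = (\<lambda>x. if x \<in> \<Omega> then real_of_ereal (u x) else 0)"
  have w_eq: "\<psi> (U x) = w x" for x by (simp add: w_def U_def)
  note w = submean_permissible[OF qns perm U_def, unfolded w_eq]
  obtain C where C: "0 < C" "\<And>x R. 0 < R \<Longrightarrow> cball x (2 * R) \<subseteq> \<Omega> \<Longrightarrow> submean C w x R"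
    using w(3) by blast
  have "ennreal (?\<delta> x powr (real ?n + \<gamma>) * w x) \<le> ennreal (3 ^ ?n * C * 2 powr \<bar>\<gamma>\<bar>) *
      (\<integral>\<^sup>+y\<in>ball x (?\<delta> x / 3). ennreal (w y * ?\<delta> y powr \<gamma>) \<partial>lebesgue)" if x: "x \<in> \<Omega>" for x
  proof -
    let ?B = "ball x (?\<delta> x / 3)"
    have \<delta>: "0 < ?\<delta> x" by (rule boundary_dist_pos[OF qns(2) x fr])
    have "cball x (2 * (?\<delta> x / 3)) \<subseteq> ball x (?\<delta> x)" using \<delta> by (auto simp: mem_cball)
    then have mv: "ennreal (w x * (?\<delta> x / 3) ^ ?n) \<le> ennreal C * (\<integral>\<^sup>+y\<in>?B. ennreal (w y) \<partial>lebesgue)"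
      unfolding submean_def[symmetric] using ball_boundary_dist_subset[OF x] \<delta> by (intro C(2)) auto
    let ?a = "?\<delta> x powr \<gamma>" and ?b = "2 powr \<bar>\<gamma>\<bar> :: real"
    let ?J = "\<integral>\<^sup>+y\<in>?B. ennreal (w y * ?\<delta> y powr \<gamma>) \<partial>lebesgue"
    have "ennreal ?a * (\<integral>\<^sup>+y\<in>?B. ennreal (w y) \<partial>lebesgue)
        = (\<integral>\<^sup>+y. ennreal ?a * (ennreal (w y) * indicator ?B y) \<partial>lebesgue)"
      by (rule nn_integral_cmult[OF borel_measurable_ennreal_ball[OF w(1)], symmetric])
    also have "\<dots> \<le> (\<integral>\<^sup>+y. ennreal ?b * (ennreal (w y * ?\<delta> y powr \<gamma>) * indicator ?B y) \<partial>lebesgue)"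
    proof (intro nn_integral_mono)
      fix y
      show "ennreal ?a * (ennreal (w y) * indicator ?B y)
          \<le> ennreal ?b * (ennreal (w y * ?\<delta> y powr \<gamma>) * indicator ?B y)"
      proof (cases "y \<in> ?B")
        case True
        have "\<bar>?\<delta> x - ?\<delta> y\<bar> \<le> dist x y"
          unfolding boundary_dist_def by (rule infdist_triangle_abs)
        then have "?a \<le> ?b * ?\<delta> y powr \<gamma>"
          using True \<delta> by (intro powr_comparable) auto
        then have "?a * w y \<le> ?b * ?\<delta> y powr \<gamma> * w y"
          using w(2) by (rule mult_right_mono)
        then have "ennreal (?a * w y) \<le> ennreal (?b * (w y * ?\<delta> y powr \<gamma>))"
          by (intro ennreal_leI) (simp add: mult_ac)
        then show ?thesis
          using True w(2)[of y] by (simp add: ennreal_mult)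
      qed simp
    qed
    also have "\<dots> = ennreal ?b * ?J"
      by (intro nn_integral_cmult borel_measurable_ennreal_ball borel_measurable_times
          powr_real_measurable borel_measurable_boundary_dist w(1)) simp
    finally have J: "ennreal ?a * (\<integral>\<^sup>+y\<in>?B. ennreal (w y) \<partial>lebesgue) \<le> ennreal ?b * ?J" .
    have eq: "?\<delta> x powr (real ?n + \<gamma>) * w x = 3 ^ ?n * (?a * (w x * (?\<delta> x / 3) ^ ?n))"
      using \<delta> by (simp add: powr_add powr_realpow power_divide)
    have "ennreal (?\<delta> x powr (real ?n + \<gamma>) * w x)
        = ennreal (3 ^ ?n) * (ennreal ?a * ennreal (w x * (?\<delta> x / 3) ^ ?n))"
      unfolding eq using w(2)[of x] \<delta> by (simp add: ennreal_mult)
    also have "\<dots> \<le> ennreal (3 ^ ?n) * (ennreal ?a * (ennreal C * (\<integral>\<^sup>+y\<in>?B. ennreal (w y) \<partial>lebesgue)))"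
      by (intro mult_left_mono mv) simp_all
    also have "\<dots> = ennreal (3 ^ ?n) * (ennreal C * (ennreal ?a * (\<integral>\<^sup>+y\<in>?B. ennreal (w y) \<partial>lebesgue)))"
      by (simp add: mult_ac)
    also have "\<dots> \<le> ennreal (3 ^ ?n) * (ennreal C * (ennreal ?b * ?J))"
      by (intro mult_left_mono J) simp_all
    also have "\<dots> = ennreal (3 ^ ?n * C * ?b) * ?J"
      using C(1) by (simp add: ennreal_mult mult.assoc)
    finally show ?thesis .
  qed
  then show ?thesis
    using C(1) by (intro exI[of _ "3 ^ ?n * C * 2 powr \<bar>\<gamma>\<bar>"]) simp
qed

section \<open>Approach regions and exceptional boundary points\<close>

text \<open>Applying the inverse to \<open>\<phi> t \<le> \<alpha> * s \<le> 2 ^ k * s\<close> and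
  doubling \<open>k\<close> times gives the bound, as long as \<open>2 ^ k * s\<close> stays in the
  doubling range. It turns the condition defining the approach region into a bound on the distance
  from \<open>x\<close> to the boundary point.\<close>

lemma inv_admissible_bound:
  fixes \<alpha> :: real
  assumes "admissible \<phi>"
  obtains K \<sigma> where "1 \<le> K" "0 < \<sigma>"
    "\<And>s t. 0 \<le> s \<Longrightarrow> s \<le> \<sigma> \<Longrightarrow> 0 \<le> t \<Longrightarrow> \<phi> t \<le> \<alpha> * s \<Longrightarrow> t \<le> K * inv_into {0..} \<phi> s"
proof -
  let ?h = "inv_into {0..} \<phi>"
  have \<phi>: "strict_mono_on {0..} \<phi>" "\<phi> ` {0..} = {0..}"
    using assms by (auto simp: admissible_def)
  note h = inv_into_strict_mono_on[OF \<phi>]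
  obtain C r where C: "1 < C" "0 < r" "\<And>s. 0 \<le> s \<Longrightarrow> s \<le> r \<Longrightarrow> ?h (2 * s) \<le> C * ?h s"
    using assms unfolding admissible_def by (metis order_refl less_imp_le)
  obtain k where k: "\<alpha> < 2 ^ k" using real_arch_pow[of 2 \<alpha>] by auto
  show ?thesis
  proof
    show "1 \<le> C ^ k" using C(1) by simp
    show "0 < r / 2 ^ k" using C(2) by simp
    fix s t assume st: "0 \<le> s" "s \<le> r / 2 ^ k" "0 \<le> t" "\<phi> t \<le> \<alpha> * s"
    have "\<alpha> * s \<le> 2 ^ k * s" using k st(1) by (intro mult_right_mono) auto
    then have 1: "\<phi> t \<le> 2 ^ k * s" using st(4) by simp
    have 2: "0 \<le> \<phi> t" using \<phi>(2) st(3) by (metis atLeast_iff imageI)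
    have 3: "2 ^ k * s \<le> r" using st(2) by (simp add: field_simps)
    have "?h (\<phi> t) \<le> C ^ k * ?h s"
      by (rule doubling_bound[where f = ?h and R = r])
        (use C 1 2 3 st(1) strict_mono_on_imp_mono_on[OF h(4)] in auto)
    then show "t \<le> C ^ k * ?h s" using h(1)[OF st(3)] by simp
  qed
qed

text \<open>The suprema shrink with \<open>\<rho>\<close>, so if for each positive level some
  \<open>A \<rho>\<close> stayed below it, all smaller scales would too and the limit would be
  0.\<close>

lemma not_tendsto_zero_SUP_at_right:
  fixes f :: "'a \<Rightarrow> ennreal" and A :: "real \<Rightarrow> 'a set"
  assumes mono: "\<And>\<rho> \<sigma>. \<rho> \<le> \<sigma> \<Longrightarrow> A \<rho> \<subseteq> A \<sigma>"
    and "\<not> ((\<lambda>\<rho>. SUP x\<in>A \<rho>. f x) \<longlongrightarrow> 0) (at_right 0)"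
  obtains \<eta> where "0 < \<eta>" "\<And>\<rho>. 0 < \<rho> \<Longrightarrow> \<exists>x\<in>A \<rho>. ennreal \<eta> < f x"
proof (rule ccontr)
  assume "\<not> thesis"
  with that have *: "\<exists>\<rho>>0. \<forall>x\<in>A \<rho>. f x \<le> ennreal \<eta>" if "0 < \<eta>" for \<eta>
    using that by (meson not_le)
  have "((\<lambda>\<rho>. SUP x\<in>A \<rho>. f x) \<longlongrightarrow> 0) (at_right 0)"
  proof (rule order_tendstoI)
    fix a :: ennreal assume "0 < a"
    \<comment> \<open>Since \<open>a\<close> may be \<open>\<infinity>\<close>, a level strictly
      below it is chosen, which is then a positive real.\<close>
    then obtain b where b: "0 < b" "b < a" using dense by blast
    then obtain \<eta> where \<eta>: "b = ennreal \<eta>" "0 < \<eta>"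
      by (metis ennreal_cases ennreal_less_zero_iff less_top_ennreal not_less_iff_gr_or_eq top.not_eq_extremum)
    obtain \<rho> where \<rho>: "0 < \<rho>" "\<forall>x\<in>A \<rho>. f x \<le> ennreal \<eta>" using *[OF \<eta>(2)] by blast
    show "\<forall>\<^sub>F \<rho> in at_right 0. (SUP x\<in>A \<rho>. f x) < a"
      using eventually_at_right_real[OF \<rho>(1)]
    proof eventually_elim
      case (elim \<sigma>)
      have "(SUP x\<in>A \<sigma>. f x) \<le> ennreal \<eta>"
        using mono[of \<sigma> \<rho>] elim \<rho>(2) by (intro SUP_least) auto
      then show ?case using b(2) \<eta>(1) by simp
    qed
  qed simp
  with assms(2) show False by contradiction
qed

text \<open>Failure of the limit at a frontier point is converted into positive upper
  \<open>d\<close>-density there of the finite measure \<open>M\<close>, to which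
  \<open>hausdorff_null_upper_density_pos\<close> applies.\<close>

lemma hausdorff_null_boundary_growth:
  fixes \<Omega> :: "'a::euclidean_space set" and u :: "'a \<Rightarrow> ereal" and d \<alpha> \<gamma> :: real
  assumes qns: "quasi_nearly_subharmonic \<Omega> u" "open \<Omega>" "\<forall>x\<in>\<Omega>. 0 \<le> u x"
    and perm: "permissible \<psi>" and adm: "admissible \<phi>" and d: "0 \<le> d"
    and fin: "(\<integral>\<^sup>+x\<in>\<Omega>. ennreal (\<psi> (real_of_ereal (u x)) * boundary_dist \<Omega> x powr \<gamma>) \<partial>lebesgue) < \<infinity>"
  shows "hausdorff_outer_measure d
    {\<zeta>\<in>frontier \<Omega>.
      \<not> ((\<lambda>\<rho>. SUP x\<in>approach_region_below \<Omega> \<phi> \<rho> \<zeta> \<alpha>.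
              ennreal (boundary_dist \<Omega> x powr (real DIM('a) + \<gamma>)
                * (inv_into {0..} \<phi> (boundary_dist \<Omega> x)) powr (- d)
                * \<psi> (real_of_ereal (u x))))
          \<longlongrightarrow> 0) (at_right 0)} = 0"
    (is "hausdorff_outer_measure d {\<zeta>\<in>_. \<not> ((\<lambda>\<rho>. SUP x\<in>_ \<rho> \<zeta>. ennreal (?e x)) \<longlongrightarrow> 0) _} = 0")
proof (cases "frontier \<Omega> = {}")
  case True
  have "hausdorff_outer_measure d ({} :: 'a set) = 0"
    unfolding hausdorff_outer_measure_eq_0_iff
    by (intro allI impI exI[of _ "\<lambda>_. {}"]) (simp add: hausdorff_gauge_def)
  then show ?thesis using True by simp
next
  case fr: False
  let ?\<delta> = "boundary_dist \<Omega>" and ?h = "inv_into {0..} \<phi>"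
  define U where "U = (\<lambda>x. if x \<in> \<Omega> then real_of_ereal (u x) else 0)"
  define w where "w = (\<lambda>x. \<psi> (if x \<in> \<Omega> then real_of_ereal (u x) else 0))"
  have w_eq: "\<psi> (U x) = w x" for x by (simp add: w_def U_def)
  note w = submean_permissible(1,2)[OF qns perm U_def, unfolded w_eq]
  have wu: "\<psi> (real_of_ereal (u x)) = w x" if "x \<in> \<Omega>" for x using that by (simp add: w_def)
  obtain C where C: "0 < C" "\<And>x. x \<in> \<Omega> \<Longrightarrow> ennreal (?\<delta> x powr (real DIM('a) + \<gamma>) * w x) \<le>
      ennreal C * (\<integral>\<^sup>+y\<in>ball x (?\<delta> x / 3). ennreal (w y * ?\<delta> y powr \<gamma>) \<partial>lebesgue)"
    using weighted_mean_value[OF qns perm fr w_def] by blast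
  \<comment> \<open>Outside \<open>\<Omega>\<close> the function \<open>w\<close> is the constant
    \<open>\<psi> 0\<close>, which may be positive. The indicator removes it and makes the frontier
    null for \<open>M\<close>.\<close>
  define F where "F x = ennreal (w x * ?\<delta> x powr \<gamma>) * indicator \<Omega> x" for x
  have F: "F \<in> borel_measurable lebesgue"
    unfolding F_def using qns(2)
    by (intro borel_measurable_times_ennreal measurable_compose[OF _ measurable_ennreal]
        borel_measurable_indicator borel_measurable_times powr_real_measurable
        borel_measurable_boundary_dist w(1)) simp_all
  define M where "M = density lebesgue F"
  have sets_M: "sets M = sets lebesgue" by (simp add: M_def)
  have borel: "sets borel \<subseteq> sets M"
    unfolding sets_M by (auto simp: sets_completionI_sets)
  have em: "emeasure M A = (\<integral>\<^sup>+x. F x * indicator A x \<partial>lebesgue)" if "A \<in> sets lebesgue" for A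
    unfolding M_def by (rule emeasure_density[OF F that])
  have "finite_measure M"
  proof (rule finite_measureI)
    have "emeasure M (space M) = (\<integral>\<^sup>+x. F x * indicator UNIV x \<partial>lebesgue)"
      using em[of UNIV] by (simp add: M_def)
    also have "\<dots> = (\<integral>\<^sup>+x\<in>\<Omega>. ennreal (\<psi> (real_of_ereal (u x)) * ?\<delta> x powr \<gamma>) \<partial>lebesgue)"
      by (intro nn_integral_cong) (auto simp: F_def wu indicator_def)
    also have "\<dots> < \<infinity>" by (rule fin)
    finally show "emeasure M (space M) \<noteq> \<infinity>" by simp
  qed
  moreover have "emeasure M (frontier \<Omega>) = 0"
  proof -
    have "frontier \<Omega> \<in> sets lebesgue" by (simp add: frontier_closed borel_closed sets_completionI_sets)
    moreover have "(\<lambda>x. F x * indicator (frontier \<Omega>) x) = (\<lambda>x. 0)"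
      using qns(2) by (auto simp: fun_eq_iff F_def indicator_def frontier_def interior_open)
    ultimately show ?thesis by (simp add: em)
  qed
  ultimately have null: "hausdorff_outer_measure d
      {z \<in> frontier \<Omega>. \<exists>c>0. \<forall>\<epsilon>>0. \<exists>t. 0 < t \<and> t < \<epsilon> \<and>
        ennreal (t powr d) \<le> ennreal c * emeasure M (cball z t)} = 0"
    using d borel by (intro hausdorff_null_upper_density_pos) simp_all
  have \<phi>: "strict_mono_on {0..} \<phi>" "\<phi> ` {0..} = {0..}"
    using adm by (auto simp: admissible_def)
  note h = inv_into_strict_mono_on[OF \<phi>]
  obtain K \<sigma> where K: "1 \<le> K" "0 < \<sigma>"
    "\<And>s t. 0 \<le> s \<Longrightarrow> s \<le> \<sigma> \<Longrightarrow> 0 \<le> t \<Longrightarrow> \<phi> t \<le> \<alpha> * s \<Longrightarrow> t \<le> K * ?h s"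
    using inv_admissible_bound[OF adm] by blast
  show ?thesis
  proof (rule hausdorff_outer_measure_mono_null[OF null], clarify)
    fix \<zeta> assume \<zeta>: "\<zeta> \<in> frontier \<Omega>"
      and nlim: "\<not> ((\<lambda>\<rho>. SUP x\<in>approach_region_below \<Omega> \<phi> \<rho> \<zeta> \<alpha>. ennreal (?e x)) \<longlongrightarrow> 0) (at_right 0)"
    have "approach_region_below \<Omega> \<phi> \<rho> \<zeta> \<alpha> \<subseteq> approach_region_below \<Omega> \<phi> \<rho>' \<zeta> \<alpha>" if "\<rho> \<le> \<rho>'" for \<rho> \<rho>'
      using that by (auto simp: approach_region_below_def)
    from not_tendsto_zero_SUP_at_right[OF this nlim] obtain \<eta> where \<eta>: "0 < \<eta>"
      "\<And>\<rho>. 0 < \<rho> \<Longrightarrow> \<exists>x\<in>approach_region_below \<Omega> \<phi> \<rho> \<zeta> \<alpha>. ennreal \<eta> < ennreal (?e x)"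
      by blast
    \<comment> \<open>The factor \<open>(2 * K) powr d\<close> comes from the radius
      \<open>t\<close> below, \<open>C\<close> from the weighted mean value inequality and
      \<open>1 / \<eta>\<close> from the level exceeded at \<open>\<zeta>\<close>.\<close>
    define c where "c = (2 * K) powr d * (C / \<eta>)"
    have "\<exists>t. 0 < t \<and> t < \<epsilon> \<and> ennreal (t powr d) \<le> ennreal c * emeasure M (cball \<zeta> t)"
      if \<epsilon>: "0 < \<epsilon>" for \<epsilon>
    proof -
      \<comment> \<open>The scale for \<open>x\<close>: below \<open>\<sigma>\<close> the distance
        bound with \<open>K\<close> holds, and below \<open>\<phi> (\<epsilon> / (2 * K))\<close>
        the radius \<open>t\<close> is less than \<open>\<epsilon>\<close>.\<close>
      have "\<phi> 0 < \<phi> (\<epsilon> / (2 * K))"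
        using \<epsilon> K(1) by (intro strict_mono_onD[OF \<phi>(1)]) auto
      then have "0 < min \<sigma> (\<phi> (\<epsilon> / (2 * K)))"
        using K(2) strict_mono_surj_zero[OF \<phi>] by simp
      from \<eta>(2)[OF this] obtain x where x: "x \<in> \<Omega>" "\<phi> (dist x \<zeta>) < \<alpha> * ?\<delta> x" "?\<delta> x < \<sigma>"
        "?\<delta> x < \<phi> (\<epsilon> / (2 * K))" "ennreal \<eta> < ennreal (?e x)"
        by (auto simp: approach_region_below_def approach_region_def)
      have \<delta>: "0 < ?\<delta> x" by (rule boundary_dist_pos[OF qns(2) x(1) fr])
      have h0: "0 < ?h (?\<delta> x)" using strict_mono_onD[OF h(4), of 0 "?\<delta> x"] h(5) \<delta> by simp
      \<comment> \<open>Points of the small ball around \<open>x\<close> are at most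
        \<open>dist x \<zeta>\<close> away from \<open>x\<close>, hence at most
        \<open>2 * dist x \<zeta>\<close> from \<open>\<zeta>\<close>; this and the bound with
        \<open>K\<close> give the factor \<open>2 * K\<close>.\<close>
      define t where "t = 2 * K * ?h (?\<delta> x)"
      have t0: "0 < t" using K(1) h0 by (simp add: t_def)
      have "?h (?\<delta> x) < ?h (\<phi> (\<epsilon> / (2 * K)))"
        using \<delta> x(4) by (intro strict_mono_onD[OF h(4)]) auto
      then have "?h (?\<delta> x) < \<epsilon> / (2 * K)" using h(1) \<epsilon> K(1) by simp
      then have t\<epsilon>: "t < \<epsilon>" using K(1) by (simp add: t_def field_simps)
      have dist: "dist x \<zeta> \<le> K * ?h (?\<delta> x)"
        using x(2,3) \<delta> by (intro K(3)) auto
      have \<delta>_le: "?\<delta> x \<le> dist x \<zeta>"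
        unfolding boundary_dist_def by (rule infdist_le[OF \<zeta>])
      have sub1: "ball x (?\<delta> x / 3) \<subseteq> cball \<zeta> t"
      proof
        fix y assume "y \<in> ball x (?\<delta> x / 3)"
        then have "dist x y \<le> dist x \<zeta>" using \<delta>_le \<delta> by simp
        then show "y \<in> cball \<zeta> t"
          using dist_triangle[of \<zeta> y x] dist by (simp add: t_def dist_commute)
      qed
      have "ball x (?\<delta> x / 3) \<subseteq> ball x (?\<delta> x)" using \<delta> by (intro subset_ball) simp
      then have sub2: "ball x (?\<delta> x / 3) \<subseteq> \<Omega>"
        using ball_boundary_dist_subset[OF x(1)] by blast
      have cb: "cball \<zeta> t \<in> sets lebesgue" by simp
      have "(\<integral>\<^sup>+y\<in>ball x (?\<delta> x / 3). ennreal (w y * ?\<delta> y powr \<gamma>) \<partial>lebesgue) \<le> emeasure M (cball \<zeta> t)"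
        unfolding em[OF cb] F_def using sub1 sub2
        by (intro nn_integral_mono) (auto simp: indicator_def)
      then have "ennreal C * (\<integral>\<^sup>+y\<in>ball x (?\<delta> x / 3). ennreal (w y * ?\<delta> y powr \<gamma>) \<partial>lebesgue)
          \<le> ennreal C * emeasure M (cball \<zeta> t)"
        by (rule mult_left_mono) simp
      with C(2)[OF x(1)] have upper: "ennreal (?\<delta> x powr (real DIM('a) + \<gamma>) * w x)
          \<le> ennreal C * emeasure M (cball \<zeta> t)"
        by (rule order_trans)
      have "\<eta> < ?e x" using x(5) \<eta>(1) by (simp add: ennreal_less_iff)
      then have "\<eta> * ?h (?\<delta> x) powr d \<le> ?\<delta> x powr (real DIM('a) + \<gamma>) * w x"
        using h0 by (simp add: wu[OF x(1)] powr_minus field_simps)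
      then have "ennreal ((2 * K) powr d / \<eta> * (\<eta> * ?h (?\<delta> x) powr d))
          \<le> ennreal ((2 * K) powr d / \<eta> * (?\<delta> x powr (real DIM('a) + \<gamma>) * w x))"
        using \<eta>(1) by (intro ennreal_leI mult_left_mono) auto
      also have "(2 * K) powr d / \<eta> * (\<eta> * ?h (?\<delta> x) powr d) = t powr d"
        using \<eta>(1) K(1) h0 by (simp add: t_def powr_mult)
      also have "ennreal ((2 * K) powr d / \<eta> * (?\<delta> x powr (real DIM('a) + \<gamma>) * w x))
          = ennreal ((2 * K) powr d / \<eta>) * ennreal (?\<delta> x powr (real DIM('a) + \<gamma>) * w x)"
        using \<eta>(1) w(2)[of x] by (intro ennreal_mult) auto
      also have "\<dots> \<le> ennreal ((2 * K) powr d / \<eta>) * (ennreal C * emeasure M (cball \<zeta> t))"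
        by (intro mult_left_mono upper) simp
      also have "\<dots> = ennreal c * emeasure M (cball \<zeta> t)"
        using C(1) \<eta>(1) by (simp add: c_def mult.assoc[symmetric] flip: ennreal_mult)
      finally show ?thesis using t0 t\<epsilon> by blast
    qed
    moreover have "0 < c" using K(1) C(1) \<eta>(1) by (simp add: c_def)
    ultimately show "\<exists>c>0. \<forall>\<epsilon>>0. \<exists>t. 0 < t \<and> t < \<epsilon> \<and>
        ennreal (t powr d) \<le> ennreal c * emeasure M (cball \<zeta> t)" by blast
  qed
qed

theorem theorem3p4:
  fixes \<Omega> :: "(real ^ 'n) set" and u :: "real ^ 'n \<Rightarrow> ereal"
    and \<phi> \<psi> :: "real \<Rightarrow> real" and d \<alpha> \<gamma> :: real
  assumes "2 \<le> CARD('n)"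
    and "open \<Omega>" "connected \<Omega>" "\<Omega> \<noteq> {}" "\<Omega> \<noteq> UNIV"
    and "0 \<le> d" "d \<le> real CARD('n)"
    and "hausdorff_outer_measure d (frontier \<Omega>) < \<infinity>"
    and "quasi_nearly_subharmonic \<Omega> u" "\<forall>x\<in>\<Omega>. 0 \<le> u x"
    and "admissible \<phi>" "0 < \<alpha>"
    and "permissible \<psi>"
    and "(\<integral>\<^sup>+x\<in>\<Omega>. ennreal (\<psi> (real_of_ereal (u x)) * boundary_dist \<Omega> x powr \<gamma>) \<partial>lebesgue) < \<infinity>"
  shows "hausdorff_outer_measure d
    {\<zeta>. accessible \<Omega> \<phi> \<alpha> \<zeta> \<and>
      \<not> ((\<lambda>\<rho>. SUP x\<in>approach_region_below \<Omega> \<phi> \<rho> \<zeta> \<alpha>.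
              ennreal (boundary_dist \<Omega> x powr (real CARD('n) + \<gamma>)
                * (inv_into {0..} \<phi> (boundary_dist \<Omega> x)) powr (- d)
                * \<psi> (real_of_ereal (u x))))
          \<longlongrightarrow> 0) (at_right 0)} = 0"
proof (rule hausdorff_outer_measure_mono_null)
  \<comment> \<open>Accessible points lie on the frontier by definition, and the dimension of
    \<open>real ^ 'n\<close> is \<open>CARD('n)\<close>.\<close>
  show "hausdorff_outer_measure d
    {\<zeta>\<in>frontier \<Omega>.
      \<not> ((\<lambda>\<rho>. SUP x\<in>approach_region_below \<Omega> \<phi> \<rho> \<zeta> \<alpha>.
              ennreal (boundary_dist \<Omega> x powr (real CARD('n) + \<gamma>)
                * (inv_into {0..} \<phi> (boundary_dist \<Omega> x)) powr (- d)
                * \<psi> (real_of_ereal (u x))))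
          \<longlongrightarrow> 0) (at_right 0)} = 0"
    using hausdorff_null_boundary_growth[of \<Omega> u \<psi> \<phi> d \<gamma> \<alpha>] assms by simp
qed (auto simp: accessible_def)

end
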